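(* Let $G$ be a finite abelian group and let $A$, $B$, $S$ be non-empty subsets of $G$. Then $$|A\oplus_S B|\geq \min\{|A|+|B|-3|S|,\ p(G)\}.$$
   Context: For subsets $A,B,S$ of an abelian group $G$ (written additively), the generalized restricted sumset is $A\oplus_S B:=\{a+b:\ a\in A,\ b\in B,\ a-b\notin S\}$. For a finite group $G$ with $|G|>1$, $p(G)$ denotes the least prime factor of $|G|$. *)

theory Defs
  imports "HOL-Computational_Algebra.Primes"
begin

definition restricted_sumset :: "'a::ab_group_add set \<Rightarrow> 'a set \<Rightarrow> 'a set \<Rightarrow> 'a set" where
  "restricted_sumset A S B = {a + b | a b. a \<in> A \<and> b \<in> B \<and> a - b \<notin> S}"

text \<open>Least prime factor of a natural number (meaningful for n > 1).\<close>
definition least_prime_factor :: "nat \<Rightarrow> nat" where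
  "least_prime_factor n = (LEAST p. prime p \<and> p dvd n)"

end

theory Submission
  imports Defs "HOL-Computational_Algebra.Polynomial"
begin

text \<open>
  Write \<open>p\<close> for the least prime factor, \<open>k\<close>, \<open>l\<close>, \<open>s\<close> for the cardinalities of \<open>A\<close>, \<open>B\<close>, \<open>S\<close>
  and \<open>M\<close> for that of the restricted sumset \<open>C\<close>, and assume \<open>M < p\<close>. The polynomial method over
  a prime field with \<open>q\<close> elements is run with multiplicities: if the fibres of \<open>A\<close>, \<open>B\<close>, \<open>C\<close>, \<open>S\<close>
  over the cosets of a subgroup \<open>K\<close> of index \<open>q\<close> satisfy
  \<open>(x - y)^n (x + y)^m \<in> (x^a, y^b)\<close> with \<open>a\<close>, \<open>b\<close>, \<open>m\<close> the fibre sizes and \<open>n\<close> a weight of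
  the fibre of \<open>S\<close>, then the product of the powers \<open>(x - y - d)^n\<close> and \<open>(x + y - c)^m\<close> lies in
  the ideal generated by the products of the \<open>(x - i)^a\<close> and of the \<open>(y - j)^b\<close>, and comparing
  leading forms gives the same membership for the total sizes and weights. Iterating, the index
  of \<open>K\<close> may be any power of \<open>q\<close>.

  In the other direction \<open>(x - y)^N (x + y)^M \<in> (x^k, y^l)\<close> forces \<open>N + M + 2 \<ge> k + l\<close> unless
  \<open>N\<close> is large, because the coefficients satisfy a three-term recurrence. An induction over
  subgroups, in which two elements of \<open>S\<close> are separated by the \<open>q'\<close>-part \<open>K\<close> of the group, gives
  \<open>M \<ge> k + l - 2 s\<close> when \<open>2 \<le> s\<close> and \<open>2 s \<le> p + 1\<close>. For larger \<open>s\<close> a single coset of \<open>K\<close> may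
  contain more than half of \<open>S\<close>; the fibres that this spoils lie over at most two cosets, and
  deleting at most \<open>s\<close> elements of \<open>A\<close> repairs them, at the price of \<open>3 s\<close> instead of \<open>2 s\<close>.
\<close>

section \<open>Binary forms with integer coefficients\<close>

definition kp :: "nat \<Rightarrow> nat \<Rightarrow> int poly" where
  "kp n m = [:-1, 1:] ^ n * [:1, 1:] ^ m"

text \<open>This says that \<open>(x - y)^n (x + y)^m\<close> lies in the ideal \<open>(q, x^a, y^b)\<close>: \<open>kp n m\<close> is the form
  dehomogenized at \<open>y = 1\<close>.\<close>
definition kp_vanish :: "nat \<Rightarrow> nat \<Rightarrow> nat \<Rightarrow> nat \<Rightarrow> nat \<Rightarrow> bool" where
  "kp_vanish q n m a b \<longleftrightarrow>
     (\<forall>u v. u < a \<longrightarrow> v < b \<longrightarrow> u + v = n + m \<longrightarrow> int q dvd coeff (kp n m) u)"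

lemma degree_kp [simp]: "degree (kp n m) = n + m"
proof -
  have "degree ([:-1, 1:] ^ n :: int poly) = n" "degree ([:1, 1:] ^ m :: int poly) = m"
    by (simp_all add: degree_power_eq)
  moreover have "degree (kp n m) = degree ([:-1, 1:] ^ n :: int poly) + degree ([:1, 1:] ^ m :: int poly)"
    unfolding kp_def by (rule degree_mult_eq) auto
  ultimately show ?thesis by simp
qed

lemma kp_Suc1: "kp (Suc n) m = [:-1, 1:] * kp n m"
  by (simp only: kp_def power_Suc mult.assoc)

lemma kp_Suc2: "kp n (Suc m) = [:1, 1:] * kp n m"
  by (simp only: kp_def power_Suc mult.left_commute)

lemma kp_0_0 [simp]: "kp 0 0 = 1"
  by (simp add: kp_def)

text \<open>The induction step that builds a binary form from its linear factors; \<open>D\<close>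
  is the formal degree used for homogenizing.\<close>

lemma homogenize_mult:
  fixes X Y :: "'r::comm_ring_1" and g :: "int poly"
  assumes "degree g \<le> D"
  shows "(\<Sum>u\<le>Suc D. of_int (coeff ([:e, 1:] * g) u) * X ^ u * Y ^ (Suc D - u))
       = (X + of_int e * Y) * (\<Sum>u\<le>D. of_int (coeff g u) * X ^ u * Y ^ (D - u))"
proof -
  have c: "coeff ([:e, 1:] * g) u = e * coeff g u + (case u of 0 \<Rightarrow> 0 | Suc n \<Rightarrow> coeff g n)" for u
    by (simp add: coeff_pCons split: nat.split)
  have z: "coeff g (Suc D) = 0" using assms by (simp add: coeff_eq_0)
  have "(\<Sum>u\<le>Suc D. of_int (coeff ([:e, 1:] * g) u) * X ^ u * Y ^ (Suc D - u))
    = (\<Sum>u\<le>Suc D. of_int e * Y * (of_int (coeff g u) * X ^ u * Y ^ (D - u)))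
      + (\<Sum>u\<le>Suc D. of_int (case u of 0 \<Rightarrow> 0 | Suc n \<Rightarrow> coeff g n) * X ^ u * Y ^ (Suc D - u))"
    unfolding sum.distrib[symmetric]
  proof (rule sum.cong)
    fix u assume u: "u \<in> {..Suc D}"
    show "of_int (coeff ([:e, 1:] * g) u) * X ^ u * Y ^ (Suc D - u)
       = of_int e * Y * (of_int (coeff g u) * X ^ u * Y ^ (D - u))
         + of_int (case u of 0 \<Rightarrow> 0 | Suc n \<Rightarrow> coeff g n) * X ^ u * Y ^ (Suc D - u)"
    \<comment> \<open>At \<open>u = Suc D\<close> the truncated exponents of \<open>Y\<close> do not
      match, but the coefficient of \<open>g\<close> is zero there.\<close>
    proof (cases "u = Suc D")
      case True
      then show ?thesis using z unfolding c by simp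
    next
      case False
      then have "Suc D - u = Suc (D - u)" using u by auto
      then show ?thesis unfolding c by (simp add: algebra_simps)
    qed
  qed simp
  also have "(\<Sum>u\<le>Suc D. of_int e * Y * (of_int (coeff g u) * X ^ u * Y ^ (D - u)))
     = of_int e * Y * (\<Sum>u\<le>D. of_int (coeff g u) * X ^ u * Y ^ (D - u))"
    using z by (simp add: sum_distrib_left)
  also have "(\<Sum>u\<le>Suc D. of_int (case u of 0 \<Rightarrow> 0 | Suc n \<Rightarrow> coeff g n) * X ^ u * Y ^ (Suc D - u))
     = X * (\<Sum>u\<le>D. of_int (coeff g u) * X ^ u * Y ^ (D - u))"
    unfolding sum.atMost_Suc_shift sum_distrib_left by (simp add: mult_ac)
  finally show ?thesis by (simp add: algebra_simps)
qed

text \<open>Stated over any commutative ring, because \<open>X\<close> and \<open>Y\<close> will be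
  translated variables \<open>x - i\<close> and \<open>y - j\<close> in a polynomial ring.\<close>

lemma kp_homogenize:
  fixes X Y :: "'r::comm_ring_1"
  shows "(X - Y) ^ n * (X + Y) ^ m
       = (\<Sum>u\<le>n + m. of_int (coeff (kp n m) u) * X ^ u * Y ^ (n + m - u))"
proof (induction n)
  case 0
  show ?case
  proof (induction m)
    case (Suc m)
    then show ?case
      using homogenize_mult[of "kp 0 m" m 1 X Y] by (simp add: kp_Suc2)
  qed simp
next
  case (Suc n)
  then show ?case
    using homogenize_mult[of "kp n m" "n + m" "-1" X Y] by (simp add: kp_Suc1 mult.assoc)
qed

section \<open>Comaximal ideals and leading forms\<close>

definition ideal3 :: "'r::comm_ring_1 \<Rightarrow> 'r \<Rightarrow> 'r \<Rightarrow> 'r set" where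
  "ideal3 q u v = {q * r + u * s + v * t | r s t. True}"

text \<open>Comaximality of \<open>u\<close> and \<open>v\<close> modulo \<open>q\<close>, as an
  explicit Bezout relation.\<close>

definition comax :: "'r::comm_ring_1 \<Rightarrow> 'r \<Rightarrow> 'r \<Rightarrow> bool" where
  "comax q u v \<longleftrightarrow> (\<exists>\<alpha> \<beta> \<gamma>. \<alpha> * u + \<beta> * v + q * \<gamma> = 1)"

lemma ideal3_commute: "ideal3 q u v = ideal3 q v u"
  unfolding ideal3_def by (auto; metis add.commute add.left_commute add.assoc)

lemma ideal3_I: "f = q * r + u * s + v * t \<Longrightarrow> f \<in> ideal3 q u v"
  unfolding ideal3_def by blast

lemma ideal3_E:
  assumes "f \<in> ideal3 q u v"
  obtains r s t where "f = q * r + u * s + v * t"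
  using assms unfolding ideal3_def by blast

lemma ideal3_add:
  assumes "f \<in> ideal3 q u v" "g \<in> ideal3 q u v"
  shows "f + g \<in> ideal3 q u v"
proof -
  obtain r s t where "f = q * r + u * s + v * t" using assms(1) by (rule ideal3_E)
  moreover obtain r' s' t' where "g = q * r' + u * s' + v * t'" using assms(2) by (rule ideal3_E)
  ultimately show ?thesis
    by (intro ideal3_I[of _ _ "r + r'" _ "s + s'" _ "t + t'"]) (simp add: algebra_simps)
qed

lemma ideal3_mult:
  assumes "f \<in> ideal3 q u v"
  shows "g * f \<in> ideal3 q u v"
proof -
  obtain r s t where "f = q * r + u * s + v * t" using assms(1) by (rule ideal3_E)
  then show ?thesis
    by (intro ideal3_I[of _ _ "g * r" _ "g * s" _ "g * t"]) (simp add: algebra_simps)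
qed

lemma ideal3_sum:
  assumes "\<And>i. i \<in> I \<Longrightarrow> f i \<in> ideal3 q u v"
  shows "sum f I \<in> ideal3 q u v"
  using assms
proof (induction I rule: infinite_finite_induct)
  case (insert x F)
  then show ?case by (simp add: ideal3_add)
qed (auto intro: ideal3_I[of _ _ 0 _ 0 _ 0])

lemma comax_commute: "comax q u v \<Longrightarrow> comax q v u"
  unfolding comax_def by (metis add.commute)

lemma comax_mult:
  assumes "comax q u v" "comax q u w"
  shows "comax q u (v * w)"
proof -
  obtain a b c where 1: "a * u + b * v + q * c = 1" using assms(1) unfolding comax_def by blast
  obtain a' b' c' where 2: "a' * u + b' * w + q * c' = 1" using assms(2) unfolding comax_def by blast
  have "(a * (a' * u + b' * w + q * c') + b * v * a') * u + (b * b') * (v * w)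
        + q * (c * (a' * u + b' * w + q * c') + b * v * c')
      = (a * u + b * v + q * c) * (a' * u + b' * w + q * c')"
    by (simp only: ring_distribs mult_ac add_ac)
  also have "\<dots> = 1" using 1 2 by simp
  finally show ?thesis unfolding comax_def by blast
qed

lemma comax_1: "comax q u 1"
  unfolding comax_def by (rule exI[of _ 0], rule exI[of _ 1], rule exI[of _ 0]) simp

lemma comax_power: "comax q u v \<Longrightarrow> comax q u (v ^ n)"
  by (induction n) (auto intro: comax_1 comax_mult)

lemma comax_prod:
  "(\<And>i. i \<in> I \<Longrightarrow> comax q u (v i)) \<Longrightarrow> comax q u (prod v I)"
  by (induction I rule: infinite_finite_induct) (auto intro: comax_1 comax_mult)

text \<open>Chinese remaindering: multiply \<open>f\<close> by the Bezout relation and, next to each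
  of \<open>u\<close> and \<open>u'\<close>, expand \<open>f\<close> by its membership for the other
  one.\<close>

lemma ideal3_comax_mult:
  assumes "f \<in> ideal3 q u v" "f \<in> ideal3 q u' v" "comax q u u'"
  shows "f \<in> ideal3 q (u * u') v"
proof -
  obtain a b c where 1: "a * u + b * u' + q * c = 1" using assms(3) unfolding comax_def by blast
  obtain r s t where 2: "f = q * r + u * s + v * t" using assms(1) by (rule ideal3_E)
  obtain r' s' t' where 3: "f = q * r' + u' * s' + v * t'" using assms(2) by (rule ideal3_E)
  have "f = (a * u + b * u' + q * c) * f" by (simp only: 1 mult_1)
  also have "\<dots> = a * u * f + b * u' * f + q * c * f" by (simp only: ring_distribs)
  also have "a * u * f = a * u * (q * r' + u' * s' + v * t')" by (simp only: 3[symmetric])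
  also have "b * u' * f = b * u' * (q * r + u * s + v * t)" by (simp only: 2[symmetric])
  finally have "f = q * (a * u * r' + b * u' * r + c * f) + (u * u') * (a * s' + b * s)
      + v * (a * u * t' + b * u' * t)"
    by (simp only: ring_distribs mult_ac add_ac)
  then show ?thesis by (rule ideal3_I)
qed

lemma ideal3_comax_prod:
  assumes "finite I" "\<And>i. i \<in> I \<Longrightarrow> f \<in> ideal3 q (u i) v"
    and "\<And>i j. i \<in> I \<Longrightarrow> j \<in> I \<Longrightarrow> i \<noteq> j \<Longrightarrow> comax q (u i) (u j)"
  shows "f \<in> ideal3 q (prod u I) v"
  using assms
proof (induction I)
  case empty
  show ?case by (rule ideal3_I[of _ _ 0 _ f _ 0]) simp
next
  case (insert x F)
  have "f \<in> ideal3 q (u x * prod u F) v"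
  proof (rule ideal3_comax_mult)
    show "comax q (u x) (prod u F)"
      using insert by (intro comax_prod) auto
  qed (use insert in auto)
  then show ?case using insert by simp
qed

text \<open>Every monomial of the form is a multiple of \<open>X ^ a\<close> or of
  \<open>Y ^ b\<close>, or has its coefficient divisible by \<open>q\<close>.\<close>

lemma kp_vanish_ideal3:
  fixes X Y :: "'r::comm_ring_1"
  assumes "kp_vanish q n m a b"
  shows "(X - Y) ^ n * (X + Y) ^ m \<in> ideal3 (of_nat q) (X ^ a) (Y ^ b)"
  unfolding kp_homogenize
proof (rule ideal3_sum)
  fix u assume u: "u \<in> {..n + m}"
  let ?f = "of_int (coeff (kp n m) u) * X ^ u * Y ^ (n + m - u)"
  consider "a \<le> u" | "b \<le> n + m - u" | "int q dvd coeff (kp n m) u"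
    using assms u unfolding kp_vanish_def by (metis atMost_iff le_add_diff_inverse not_le_imp_less)
  then show "?f \<in> ideal3 (of_nat q) (X ^ a) (Y ^ b)"
  proof cases
    case 1
    then have "X ^ u = X ^ a * X ^ (u - a)" by (simp flip: power_add)
    then show ?thesis
      by (intro ideal3_I[of _ _ 0 _ "of_int (coeff (kp n m) u) * X ^ (u - a) * Y ^ (n + m - u)" _ 0])
        (simp add: mult_ac)
  next
    case 2
    then have "Y ^ (n + m - u) = Y ^ b * Y ^ (n + m - u - b)"
      by (metis le_add_diff_inverse power_add)
    then show ?thesis
      by (intro ideal3_I[of _ _ 0 _ 0 _ "of_int (coeff (kp n m) u) * X ^ u * Y ^ (n + m - u - b)"])
        (simp add: mult_ac)
  next
    case 3
    then obtain c where "coeff (kp n m) u = int q * c" by (rule dvdE)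
    then show ?thesis
      by (intro ideal3_I[of _ _ "of_int c * X ^ u * Y ^ (n + m - u)" _ 0 _ 0]) (simp add: mult_ac)
  qed
qed

text \<open>Newton's divided difference of \<open>h\<close> at a list of nodes. Synthetic division
  replaces quotients, so repeated nodes are allowed and no inverses are required.\<close>

fun divdiff :: "'r::comm_ring_1 list \<Rightarrow> 'r poly \<Rightarrow> 'r" where
  "divdiff [] h = 0"
| "divdiff [i] h = poly h i"
| "divdiff (i # j # is) h = divdiff (j # is) (synthetic_div h i)"

lemma synthetic_div_add:
  fixes p r :: "'r::comm_ring_1 poly"
  shows "synthetic_div (p + r) c = synthetic_div p c + synthetic_div r c"
proof -
  have "(p + r) + smult c (synthetic_div p c + synthetic_div r c)
     = pCons (poly p c + poly r c) (synthetic_div p c + synthetic_div r c)"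
    using synthetic_div_correct[of p c] synthetic_div_correct[of r c]
    by (simp add: smult_add_right algebra_simps)
       (metis add_pCons add.assoc add.left_commute)
  from synthetic_div_unique[OF this] show ?thesis by simp
qed

lemma synthetic_div_smult:
  fixes p :: "'r::comm_ring_1 poly"
  shows "synthetic_div (smult a p) c = smult a (synthetic_div p c)"
proof -
  have "smult a p + smult c (smult a (synthetic_div p c))
     = smult a (p + smult c (synthetic_div p c))"
    by (simp add: smult_add_right mult.commute)
  also have "\<dots> = pCons (a * poly p c) (smult a (synthetic_div p c))"
    by (simp add: synthetic_div_correct)
  finally show ?thesis using synthetic_div_unique by metis
qed

lemma synthetic_div_mult:
  fixes h :: "'r::comm_ring_1 poly"
  shows "synthetic_div ([:-c, 1:] * h) c = h"
proof -
  have "[:-c, 1:] * h + smult c h = pCons 0 h" by simp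
  from synthetic_div_unique[OF this] show ?thesis by simp
qed

lemma divdiff_add: "divdiff is (p + r) = divdiff is p + divdiff is r"
  by (induction "is" p arbitrary: r rule: divdiff.induct) (auto simp: synthetic_div_add)

lemma divdiff_smult: "divdiff is (smult a p) = a * divdiff is p"
  by (induction "is" p rule: divdiff.induct) (auto simp: synthetic_div_smult)

text \<open>Each synthetic division strips off one linear factor, and the last node is a root of
  what is left. Repeated nodes account for multiplicities.\<close>

lemma divdiff_mult: "is \<noteq> [] \<Longrightarrow> divdiff is ((\<Prod>i\<leftarrow>is. [:-i, 1:]) * h) = 0"
proof (induction "is" rule: induct_list012)
  case (3 i j "is")
  have "(\<Prod>i\<leftarrow>i # j # is. [:-i, 1:]) * h = [:-i, 1:] * ((\<Prod>i\<leftarrow>j # is. [:-i, 1:]) * h)"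
    by (simp only: list.map prod_list.Cons mult.assoc)
  then have "synthetic_div ((\<Prod>i\<leftarrow>i # j # is. [:-i, 1:]) * h) i = (\<Prod>i\<leftarrow>j # is. [:-i, 1:]) * h"
    by (simp only: synthetic_div_mult)
  then show ?case
    using 3 by simp
qed auto

lemma coeff_synthetic_div:
  "coeff p (Suc n) + c * coeff (synthetic_div p c) (Suc n) = coeff (synthetic_div p c) n"
  using arg_cong[OF synthetic_div_correct[of p c], of "\<lambda>r. coeff r (Suc n)"] by simp

lemma coeff_synthetic_div_top:
  assumes "degree p \<le> Suc n"
  shows "coeff (synthetic_div p c) n = coeff p (Suc n)"
  using coeff_synthetic_div[of p n c] assms by (simp add: coeff_eq_0 degree_synthetic_div)

text \<open>Synthetic division lowers the degree bound by one and keeps the top coefficient.\<close>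

lemma divdiff_eq_coeff:
  assumes "is \<noteq> []" "degree h < length is"
  shows "divdiff is h = coeff h (length is - 1)"
  using assms
proof (induction "is" h rule: divdiff.induct)
  case (2 i h)
  then show ?case using degree_eq_zeroE[of h] by force
next
  case (3 i j "is" h)
  then have "divdiff (j # is) (synthetic_div h i) = coeff (synthetic_div h i) (length is)"
    by (simp add: degree_synthetic_div)
  then show ?case
    using coeff_synthetic_div_top[of h "length is" i] 3 by simp
qed simp

text \<open>In \<open>int poly poly\<close> the outer variable is \<open>y\<close>, the inner one \<open>x\<close>. The total degree
  of \<open>f\<close> is at most \<open>D\<close>, and \<open>g\<close> is the dehomogenized (\<open>y = 1\<close>) part of degree \<open>D\<close>.\<close>
definition leading_form :: "nat \<Rightarrow> int poly poly \<Rightarrow> int poly \<Rightarrow> bool" where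
  "leading_form D f g \<longleftrightarrow>
     (\<forall>u v. u + v > D \<longrightarrow> coeff (coeff f v) u = 0) \<and>
     (\<forall>u v. u + v = D \<longrightarrow> coeff (coeff f v) u = coeff g u)"

lemma coeff_mult_inner_X:
  "coeff (coeff ([:[:0, 1:]:] * f) v) u = (case u of 0 \<Rightarrow> 0 | Suc n \<Rightarrow> coeff (coeff f v) n)"
  for f :: "int poly poly"
  by (simp add: coeff_pCons split: nat.split)

text \<open>The factor is \<open>x + c + e * y\<close>; the constant \<open>c\<close> does not reach
  the leading form.\<close>

lemma leading_form_linear:
  assumes "leading_form D f g" "degree g \<le> D"
  shows "leading_form (Suc D) (([:[:c, 1:], [:e:]:]) * f) ([:e, 1:] * g)"
proof -
  have 1: "coeff (coeff ([:[:c, 1:], [:e:]:] * f) v) u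
     = c * coeff (coeff f v) u + (case u of 0 \<Rightarrow> 0 | Suc n \<Rightarrow> coeff (coeff f v) n)
       + (case v of 0 \<Rightarrow> 0 | Suc n \<Rightarrow> e * coeff (coeff f n) u)" for u v
    by (simp add: coeff_pCons split: nat.split)
  have 2: "coeff ([:e, 1:] * g) u = e * coeff g u + (case u of 0 \<Rightarrow> 0 | Suc n \<Rightarrow> coeff g n)" for u
    by (simp add: coeff_pCons split: nat.split)
  have 3: "coeff g (Suc D) = 0" using assms(2) by (simp add: coeff_eq_0)
  show ?thesis
    using assms(1) 3 unfolding leading_form_def 1 2
    by (auto split: nat.split)
qed

lemma leading_form_X:
  assumes "leading_form D f g"
  shows "leading_form (Suc D) ([:[:0, 1:]:] * f) (pCons 0 g)"
  using assms unfolding leading_form_def coeff_mult_inner_X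
  by (auto simp: coeff_pCons split: nat.split)

lemma leading_form_Y:
  assumes "leading_form D f g" "degree g \<le> D"
  shows "leading_form (Suc D) (pCons 0 f) g"
proof -
  have "coeff g (Suc D) = 0" using assms(2) by (simp add: coeff_eq_0)
  then show ?thesis
    using assms unfolding leading_form_def by (auto simp: coeff_pCons split: nat.split)
qed

lemma leading_form_linear_power:
  assumes "leading_form D f g" "degree g \<le> D"
  shows "leading_form (D + n) ([:[:c, 1:], [:e:]:] ^ n * f) ([:e, 1:] ^ n * g)"
proof (induction n)
  case (Suc n)
  have "degree ([:e, 1:] ^ n * g) \<le> D + n"
    by (rule order.trans[OF degree_mult_le]) (use assms(2) in \<open>simp add: degree_power_eq\<close>)
  from leading_form_linear[OF Suc this] show ?case
    by (simp only: power_Suc mult.assoc add_Suc_right)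
qed (use assms in simp)

lemma leading_form_linear_prod:
  assumes "finite I" "leading_form D f g" "degree g \<le> D"
  shows "leading_form (D + sum n I) ((\<Prod>i\<in>I. [:[:c i, 1:], [:e:]:] ^ n i) * f)
           ([:e, 1:] ^ sum n I * g)"
  using assms(1)
proof (induction I)
  case (insert i I)
  have "degree ([:e, 1:] ^ sum n I * g) \<le> D + sum n I"
    by (rule order.trans[OF degree_mult_le]) (use assms(3) in \<open>simp add: degree_power_eq\<close>)
  from leading_form_linear_power[OF insert.IH this, of "n i" "c i" e] insert.hyps show ?case
    by (simp add: power_add mult.assoc add_ac del: mult_pCons_left mult_pCons_right)
qed (use assms in simp)

lemma leading_form_X_power:
  "leading_form D f g \<Longrightarrow> leading_form (D + n) ([:[:0, 1:]:] ^ n * f) (monom 1 n * g)"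
proof (induction n)
  case (Suc n)
  then show ?case
    using leading_form_X[of "D + n"]
    by (simp add: monom_Suc mult.assoc mult_pCons_left[of 0 "monom 1 n"] del: mult_pCons_left)
qed simp

lemma leading_form_Y_power:
  assumes "leading_form D f g" "degree g \<le> D"
  shows "leading_form (D + n) ([:0, 1:] ^ n * f) g"
proof (induction n)
  case (Suc n)
  then show ?case
    using leading_form_Y[of "D + n"] assms(2) by (simp add: mult.assoc)
qed (use assms in simp)

text \<open>Division by \<open>y - j\<close>. The coefficient recursion is followed downward in the
  \<open>y\<close>-degree, from where the quotient vanishes; its term with factor \<open>j\<close>
  has too high a total degree to contribute to the leading form.\<close>

lemma leading_form_synthetic_div:
  assumes "leading_form (Suc D) f g"
  shows "leading_form D (synthetic_div f [:j:]) g"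
proof -
  let ?s = "synthetic_div f [:j:]"
  have r: "coeff (coeff ?s v) u = coeff (coeff f (Suc v)) u + j * coeff (coeff ?s (Suc v)) u" for u v
    by (simp flip: coeff_synthetic_div[of f v "[:j:]"])
  have z: "coeff (coeff ?s v) u = 0" if "v \<ge> degree f" for u v
  proof (cases "degree f = 0")
    case True
    then have "?s = 0" using synthetic_div_eq_0_iff by blast
    then show ?thesis by simp
  qed (use that in \<open>simp add: coeff_eq_0 degree_synthetic_div\<close>)
  have a: "u + v > D \<longrightarrow> coeff (coeff ?s v) u = 0" for u v
  proof (induction "degree f - v" arbitrary: v)
    case (Suc n)
    then have "u + v > D \<longrightarrow> coeff (coeff ?s (Suc v)) u = 0" by auto
    then show ?case using assms r[where v=v] unfolding leading_form_def by auto
  qed (use z in auto)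
  moreover have "coeff (coeff ?s v) u = coeff g u" if "u + v = D" for u v
  proof -
    have "coeff (coeff ?s (Suc v)) u = 0" using a[of u "Suc v"] that by simp
    moreover have "coeff (coeff f (Suc v)) u = coeff g u"
      using assms that unfolding leading_form_def by simp
    ultimately show ?thesis using r[where u=u and v=v] by simp
  qed
  ultimately show ?thesis unfolding leading_form_def by blast
qed

text \<open>All nodes but the last lower the total degree by one without changing the form, and
  substituting the last one for \<open>y\<close> affects only lower coefficients.\<close>

lemma coeff_divdiff:
  assumes "js \<noteq> []" "leading_form (D + (length js - 1)) f g"
  shows "degree (divdiff (map (\<lambda>j. [:j:]) js) f) \<le> D"
    and "coeff (divdiff (map (\<lambda>j. [:j:]) js) f) D = coeff g D"
proof -
  have "(\<forall>u>D. coeff (divdiff (map (\<lambda>j. [:j:]) js) f) u = 0)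
      \<and> coeff (divdiff (map (\<lambda>j. [:j:]) js) f) D = coeff g D"
    using assms
  proof (induction js arbitrary: f rule: induct_list012)
    case (2 j)
    then have f: "leading_form D f g" by simp
    let ?s = "synthetic_div f [:j:]"
    have r: "poly f [:j:] = coeff f 0 + smult j (coeff ?s 0)"
      using arg_cong[OF synthetic_div_correct[of f "[:j:]"], of "\<lambda>r. coeff r 0"] by simp
    have s: "coeff (coeff ?s 0) u = 0" if "u \<ge> D" for u
    proof (cases D)
      case 0
      have "degree f = 0"
        using f 0 unfolding leading_form_def
        by (metis add_gr_0 coeff_0 leading_coeff_0_iff poly_eqI degree_0 gr0I)
      then have "?s = 0" using synthetic_div_eq_0_iff by blast
      then show ?thesis by simp
    next
      case (Suc D')
      then show ?thesis
        using leading_form_synthetic_div[of D' f g j] f that unfolding leading_form_def by auto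
    qed
    show ?case using f unfolding leading_form_def by (auto simp: r s)
  next
    case (3 i j js)
    then show ?case using leading_form_synthetic_div[of "D + length js" f g i] by simp
  qed simp
  then show "degree (divdiff (map (\<lambda>j. [:j:]) js) f) \<le> D"
    and "coeff (divdiff (map (\<lambda>j. [:j:]) js) f) D = coeff g D"
    by (auto intro: degree_le)
qed

text \<open>A Combinatorial Nullstellensatz with multiplicities. Divided differences in
  \<open>y\<close> along \<open>js\<close>, then in \<open>x\<close> along \<open>is\<close>,
  annihilate the two products and leave a multiple of \<open>q\<close>; on \<open>f\<close> itself
  they read off the leading coefficient.\<close>

lemma leading_form_ideal3:
  fixes f :: "int poly poly"
  assumes f: "f \<in> ideal3 (of_nat q) (\<Prod>i\<leftarrow>is. [:[:-i, 1:]:]) (\<Prod>j\<leftarrow>js. [:-[:j:], 1:])"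
    and lf: "leading_form (length is - 1 + (length js - 1)) f g"
    and ne: "is \<noteq> []" "js \<noteq> []"
  shows "int q dvd coeff g (length is - 1)"
proof -
  let ?U = "\<Prod>i\<leftarrow>is. [:-i, 1:]" and ?js = "map (\<lambda>j. [:j:]) js"
  have U: "(\<Prod>i\<leftarrow>is. [:[:-i, 1:]:]) = [:?U:]"
    by (induction "is") (simp_all add: one_pCons)
  have V: "(\<Prod>j\<leftarrow>js. [:-[:j:], 1:]) = (\<Prod>j\<leftarrow>?js. [:-j, 1:])"
    by (simp add: comp_def)
  obtain r s t where rst: "f = of_nat q * r + [:?U:] * s + (\<Prod>j\<leftarrow>?js. [:-j, 1:]) * t"
    using f unfolding U V by (rule ideal3_E)
  have q: "(of_nat q :: int poly poly) * r = smult (of_nat q) r"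
    by (simp add: of_nat_poly)
  have "divdiff ?js f = of_nat q * divdiff ?js r + ?U * divdiff ?js s"
    unfolding rst divdiff_add q using ne
    by (simp add: divdiff_smult divdiff_mult del: map_map)
  then have "divdiff is (divdiff ?js f) = of_nat q * divdiff is (divdiff ?js r)"
    using ne by (simp add: divdiff_add divdiff_smult divdiff_mult of_nat_poly)
  moreover have "divdiff is (divdiff ?js f) = coeff g (length is - 1)"
    using coeff_divdiff[OF ne(2) lf] divdiff_eq_coeff[OF ne(1)] ne
    by (metis diff_less le_less_trans length_greater_0_conv zero_less_one)
  ultimately show ?thesis by simp
qed

section \<open>Congruences modulo \<open>q\<close> and the gluing of local memberships\<close>

lemma ideal3_trans_mod:
  assumes "f \<in> ideal3 q u v" "q dvd g - f"
  shows "g \<in> ideal3 q u v"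
proof -
  obtain h where "g - f = q * h" using assms(2) by (rule dvdE)
  moreover have "q * h \<in> ideal3 q u v" by (rule ideal3_I[of _ _ h _ 0 _ 0]) simp
  ultimately show ?thesis using ideal3_add[OF assms(1)] by (metis add.commute diff_add_cancel)
qed

lemma dvd_mult_diff:
  fixes q :: "'r::comm_ring_1"
  assumes "q dvd a - a'" "q dvd b - b'"
  shows "q dvd a * b - a' * b'"
proof -
  have "a * b - a' * b' = (a - a') * b + a' * (b - b')" by (simp add: algebra_simps)
  then show ?thesis using assms by simp
qed

lemma dvd_power_diff:
  fixes q :: "'r::comm_ring_1"
  shows "q dvd a - a' \<Longrightarrow> q dvd a ^ n - a' ^ n"
  by (induction n) (auto intro: dvd_mult_diff)

text \<open>The difference \<open>i - j\<close> is a unit modulo \<open>q\<close>, so the two linear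
  polynomials combine to 1.\<close>

lemma comax_residues:
  fixes z :: "'r::comm_ring_1"
  assumes "prime q" "i < q" "j < q" "i \<noteq> j"
  shows "comax (of_nat q) ((z - of_nat i) ^ a) ((z - of_nat j) ^ b)"
proof -
  have "coprime (int i - int j) (int q)"
  proof -
    have "\<not> int q dvd int i - int j"
    proof
      assume "int q dvd int i - int j"
      then have "\<bar>int q\<bar> \<le> \<bar>int i - int j\<bar>" using assms by (intro dvd_imp_le_int) auto
      then show False using assms by auto
    qed
    then show ?thesis
      using assms(1) by (metis coprime_commute prime_imp_coprime prime_nat_int_transfer)
  qed
  then obtain x y where "x * (int i - int j) + y * int q = 1"
    using bezout_int[of "int i - int j" "int q"] by (metis coprime_imp_gcd_eq_1)
  then have "of_int (x * (int i - int j) + y * int q) = (of_int 1 :: 'r)" by (rule arg_cong)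
  then have xy: "of_int x * (of_nat i - of_nat j) + of_int y * of_nat q = (1::'r)" by simp
  have "(- of_int x) * (z - of_nat i) + of_int x * (z - of_nat j) + of_nat q * of_int y
     = of_int x * (of_nat i - of_nat j) + of_int y * of_nat q"
    by (simp add: right_diff_distrib mult.commute)
  with xy have "comax (of_nat q) (z - of_nat i) (z - of_nat j)"
    unfolding comax_def by metis
  then show ?thesis by (blast intro: comax_commute comax_power)
qed

lemma prod_list_concat_replicate:
  "prod_list (map f (concat (map (\<lambda>i. replicate (n i) i) is))) = (\<Prod>i\<leftarrow>is. f i ^ n i :: 'r::comm_monoid_mult)"
  by (induction "is") (simp_all add: map_concat prod_list_replicate)

text \<open>At the node \<open>(i, j)\<close> the factors of \<open>f\<close> indexed by the
  residues of \<open>i - j\<close> and \<open>i + j\<close> form the local binary form in the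
  translated variables, up to multiples of \<open>q\<close>; the other factors only multiply
  it.\<close>

lemma kp_vanish_sum:
  fixes w m a b :: "nat \<Rightarrow> nat"
  assumes q: "prime q"
    and loc: "\<And>i j. i < q \<Longrightarrow> j < q \<Longrightarrow>
      kp_vanish q (w ((i + q - j) mod q)) (m ((i + j) mod q)) (a i) (b j)"
  shows "kp_vanish q (sum w {..<q}) (sum m {..<q}) (sum a {..<q}) (sum b {..<q})"
proof -
  define x :: "int poly poly" where "x = [:[:0, 1:]:]"
  define y :: "int poly poly" where "y = [:0, 1:]"
  define f where "f = (\<Prod>d<q. (x - y - of_nat d) ^ w d) * (\<Prod>c<q. (x + y - of_nat c) ^ m c)"
  let ?q = "of_nat q :: int poly poly"
  have modq: "?q dvd of_nat s - of_nat (s mod q)" for s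
  proof -
    have "of_nat s = of_nat (s mod q) + ?q * of_nat (s div q)"
      by (metis mod_mult_div_eq of_nat_add of_nat_mult)
    then show ?thesis by simp
  qed
  have "f \<in> ideal3 ?q ((x - of_nat i) ^ a i) ((y - of_nat j) ^ b j)" if ij: "i < q" "j < q" for i j
  proof -
    define d c where "d = (i + q - j) mod q" and "c = (i + j) mod q"
    let ?X = "x - of_nat i" and ?Y = "y - of_nat j"
    have "(?X - ?Y) ^ w d * (?X + ?Y) ^ m c \<in> ideal3 ?q (?X ^ a i) (?Y ^ b j)"
      using loc[OF ij] unfolding d_def c_def by (rule kp_vanish_ideal3)
    moreover have "?q dvd (x - y - of_nat d) ^ w d * (x + y - of_nat c) ^ m c
        - (?X - ?Y) ^ w d * (?X + ?Y) ^ m c"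
    proof (intro dvd_mult_diff dvd_power_diff)
      \<comment> \<open>The added \<open>q\<close> keeps the subtraction of naturals exact and
        disappears modulo \<open>q\<close>.\<close>
      have "of_nat (i + q - j) = of_nat i + ?q - of_nat j" using ij by (simp add: of_nat_diff)
      then have "x - y - of_nat d - (?X - ?Y) = (of_nat (i + q - j) - of_nat d) - ?q"
        by (simp add: algebra_simps)
      moreover have "?q dvd (of_nat (i + q - j) - of_nat d) - ?q"
        using modq[of "i + q - j"] unfolding d_def by (rule dvd_diff) simp
      ultimately show "?q dvd x - y - of_nat d - (?X - ?Y)" by (simp only:)
      have "x + y - of_nat c - (?X + ?Y) = of_nat (i + j) - of_nat c"
        by (simp only: of_nat_add algebra_simps)
      then show "?q dvd x + y - of_nat c - (?X + ?Y)"
        using modq[of "i + j"] by (simp only: c_def)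
    qed
    ultimately have "(x - y - of_nat d) ^ w d * (x + y - of_nat c) ^ m c
        \<in> ideal3 ?q (?X ^ a i) (?Y ^ b j)" by (rule ideal3_trans_mod)
    moreover have "(x - y - of_nat d) ^ w d * (x + y - of_nat c) ^ m c dvd f"
      unfolding f_def using ij by (intro mult_dvd_mono dvd_prodI) (auto simp: d_def c_def)
    ultimately show ?thesis by (metis dvd_def ideal3_mult mult.commute)
  qed
  \<comment> \<open>Chinese remaindering in \<open>x\<close> for fixed \<open>j\<close>, then in
    \<open>y\<close>.\<close>
  then have "f \<in> ideal3 ?q (\<Prod>i<q. (x - of_nat i) ^ a i) ((y - of_nat j) ^ b j)" if "j < q" for j
    using that comax_residues[OF q] by (intro ideal3_comax_prod) auto
  then have "f \<in> ideal3 ?q (\<Prod>j<q. (y - of_nat j) ^ b j) (\<Prod>i<q. (x - of_nat i) ^ a i)"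
    using comax_residues[OF q] by (intro ideal3_comax_prod) (auto simp: ideal3_commute)
  then have f: "f \<in> ideal3 ?q (\<Prod>i<q. (x - of_nat i) ^ a i) (\<Prod>j<q. (y - of_nat j) ^ b j)"
    by (simp only: ideal3_commute)
  \<comment> \<open>Roots are listed with multiplicity, to serve as nodes of the divided
    differences.\<close>
  define roots where "roots n = map int (concat (map (\<lambda>i. replicate (n i) i) [0..<q]))" for n
  have len: "length (roots n) = sum n {..<q}" for n
    by (simp add: roots_def length_concat comp_def interv_sum_list_conv_sum_set_nat atLeast0LessThan)
  have "(\<Prod>i\<leftarrow>roots a. [:[:-i, 1:]:]) = (\<Prod>i\<leftarrow>[0..<q]. [:[:-int i, 1:]:] ^ a i)"
    unfolding roots_def map_map comp_def by (rule prod_list_concat_replicate)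
  also have "\<dots> = (\<Prod>i<q. (x - of_nat i) ^ a i)"
    by (simp add: x_def of_nat_poly atLeast0LessThan flip: prod.distinct_set_conv_list)
  finally have U: "(\<Prod>i<q. (x - of_nat i) ^ a i) = (\<Prod>i\<leftarrow>roots a. [:[:-i, 1:]:])" by simp
  have "(\<Prod>j\<leftarrow>roots b. [:-[:j:], 1:]) = (\<Prod>i\<leftarrow>[0..<q]. [:-[:int i:], 1:] ^ b i)"
    unfolding roots_def map_map comp_def by (rule prod_list_concat_replicate)
  also have "\<dots> = (\<Prod>j<q. (y - of_nat j) ^ b j)"
    by (simp add: y_def of_nat_poly atLeast0LessThan flip: prod.distinct_set_conv_list)
  finally have V: "(\<Prod>j<q. (y - of_nat j) ^ b j) = (\<Prod>j\<leftarrow>roots b. [:-[:j:], 1:])" by simp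
  have "leading_form 0 1 1"
    unfolding leading_form_def by auto
  then have "leading_form (0 + sum m {..<q})
      ((\<Prod>c<q. [:[:- int c, 1:], [:1:]:] ^ m c) * 1) ([:1, 1:] ^ sum m {..<q} * 1)"
    by (rule leading_form_linear_prod[OF finite_lessThan]) simp
  then have "leading_form (0 + sum m {..<q} + sum w {..<q})
      ((\<Prod>d<q. [:[:- int d, 1:], [:-1:]:] ^ w d) * ((\<Prod>c<q. [:[:- int c, 1:], [:1:]:] ^ m c) * 1))
      ([:-1, 1:] ^ sum w {..<q} * ([:1, 1:] ^ sum m {..<q} * 1))"
    by (rule leading_form_linear_prod[OF finite_lessThan]) (simp add: degree_power_eq)
  moreover have "[:[:- int d, 1:], [:-1:]:] = x - y - of_nat d" "[:[:- int d, 1:], [:1:]:] = x + y - of_nat d" for d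
    by (simp_all add: x_def y_def of_nat_poly one_pCons)
  ultimately have lf: "leading_form (sum w {..<q} + sum m {..<q}) f (kp (sum w {..<q}) (sum m {..<q}))"
    by (simp add: f_def kp_def add.commute)
  show ?thesis
    unfolding kp_vanish_def
  proof (intro allI impI)
    fix u v assume uv: "u < sum a {..<q}" "v < sum b {..<q}" "u + v = sum w {..<q} + sum m {..<q}"
    \<comment> \<open>Multiplying by \<open>x ^ ?r * y ^ ?s\<close> raises the total degree to the
      one that \<open>leading_form_ideal3\<close> expects and moves the coefficient at
      \<open>u\<close> to the position it reads.\<close>
    let ?r = "sum a {..<q} - 1 - u" and ?s = "sum b {..<q} - 1 - v"
    let ?k = "kp (sum w {..<q}) (sum m {..<q})"
    have "leading_form (u + v + ?s) (y ^ ?s * f) ?k"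
      unfolding y_def using lf uv(3) by (intro leading_form_Y_power) auto
    then have "leading_form (u + v + ?s + ?r) (x ^ ?r * (y ^ ?s * f)) (monom 1 ?r * ?k)"
      unfolding x_def by (rule leading_form_X_power)
    moreover have "u + v + ?s + ?r = length (roots a) - 1 + (length (roots b) - 1)"
      using uv by (simp add: len)
    moreover have "x ^ ?r * (y ^ ?s * f) \<in> ideal3 ?q (\<Prod>i\<leftarrow>roots a. [:[:-i, 1:]:]) (\<Prod>j\<leftarrow>roots b. [:-[:j:], 1:])"
      using f unfolding U V by (intro ideal3_mult)
    moreover have "roots a \<noteq> []" "roots b \<noteq> []"
      using len[of a] len[of b] uv by auto
    ultimately have "int q dvd coeff (monom 1 ?r * ?k) (length (roots a) - 1)"
      using leading_form_ideal3[of "x ^ ?r * (y ^ ?s * f)" q "roots a" "roots b"] by (simp only:) simp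
    moreover have "\<not> sum a {..<q} - 1 < ?r" "sum a {..<q} - 1 - ?r = u"
      using uv by auto
    ultimately show "int q dvd coeff ?k u"
      by (simp only: len coeff_monom_mult if_False mult_1)
  qed
qed

section \<open>Non-membership\<close>

text \<open>The logarithmic derivative of the form, cleared of its denominator
  \<open>x^2 - 1\<close>.\<close>

lemma kp_ode:
  "pderiv (kp n m) * [:-1, 0, 1:] = (of_nat n * [:1, 1:] + of_nat m * [:-1, 1:]) * kp n m"
proof -
  have 1: "pderiv ([:c, 1:] ^ n) * [:c, 1:] = of_nat n * [:c, 1:] ^ n" for n and c :: int
  proof (cases n)
    case (Suc k)
    have "pderiv ([:c, 1:] ^ n) = of_nat n * [:c, 1:] ^ k"
      unfolding Suc pderiv_power_Suc by (simp add: pderiv_pCons of_nat_poly)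
    then show ?thesis by (simp add: Suc mult_ac del: mult_pCons_left mult_pCons_right of_nat_Suc)
  qed simp
  have "[:-1, 0, 1:] = [:-1, 1:] * [:1, 1 :: int:]" by simp
  then have "pderiv (kp n m) * [:-1, 0, 1:]
     = (pderiv ([:-1, 1:] ^ n) * [:-1, 1:]) * [:1, 1:] ^ m * [:1, 1:]
       + (pderiv ([:1, 1:] ^ m) * [:1, 1:]) * [:-1, 1:] ^ n * [:-1, 1:]"
    unfolding kp_def pderiv_mult by (simp only: ring_distribs mult_ac add_ac)
  also have "\<dots> = (of_nat n * [:1, 1:] + of_nat m * [:-1, 1:]) * kp n m"
    unfolding 1 kp_def by (simp only: ring_distribs mult_ac add_ac)
  finally show ?thesis .
qed

text \<open>The operator of \<open>kp_ode\<close> after replacing \<open>x\<close> by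
  \<open>x - 1\<close>. Expanded at its singular point 0, it yields a two-term recurrence.\<close>

lemma coeff_ode:
  fixes P :: "int poly"
  shows "coeff (pderiv P * [:0, -2, 1:] - (of_nat n * [:0, 1:] + of_nat m * [:-2, 1:]) * P) r
    = 2 * (int m - int r) * coeff P r - (case r of 0 \<Rightarrow> 0 | Suc s \<Rightarrow> (int n + int m - int s) * coeff P s)"
proof -
  have "coeff (pderiv P * [:0, -2, 1:]) r
     = (case r of 0 \<Rightarrow> 0 | Suc s \<Rightarrow> int s * coeff P s) - 2 * int r * coeff P r"
    by (cases r rule: nat.exhaust; cases "r - 1")
       (auto simp: mult.commute[of "pderiv P"] coeff_pderiv coeff_pCons split: nat.split)
  moreover have "coeff ((of_nat n * [:0, 1:] + of_nat m * [:-2, 1:]) * P) r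
     = (case r of 0 \<Rightarrow> 0 | Suc s \<Rightarrow> (int n + int m) * coeff P s) - 2 * int m * coeff P r"
    by (auto simp: of_nat_poly coeff_pCons algebra_simps split: nat.split)
  ultimately show ?thesis by (auto simp: algebra_simps split: nat.split)
qed

text \<open>Vanishing would make at least two consecutive coefficients zero modulo \<open>q\<close>.
  The part of the form below this gap then solves the same differential equation modulo
  \<open>q\<close>, and is forced to be zero although its constant term is a sign.\<close>

lemma not_kp_vanish:
  assumes q: "prime q" "odd q" and M: "M < q" and d: "N + M + 3 \<le> k + l" and k: "k \<ge> 1" "l \<ge> 1"
    and N: "\<And>r. l \<le> r \<Longrightarrow> r \<le> N \<Longrightarrow> \<not> q dvd r"
  shows "\<not> kp_vanish q N M k l"
proof
  assume van: "kp_vanish q N M k l"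
  let ?g = "kp N M"
  have pq: "prime (int q)" using q(1) by simp
  have "q \<noteq> 2" using q(2) by auto
  then have q2: "q > 2" using prime_ge_2_nat[OF q(1)] by simp
  have g0: "\<not> int q dvd coeff ?g 0"
  proof -
    have "coeff ?g 0 = (-1) ^ N"
      by (simp add: kp_def coeff_mult coeff_0_power)
    then show ?thesis using q(1) by (auto simp: minus_one_power_iff)
  qed
  have lD: "l \<le> N + M"
  proof (rule ccontr)
    assume "\<not> l \<le> N + M"
    then have "int q dvd coeff ?g 0"
      using van k unfolding kp_vanish_def by (metis add_0 less_eq_Suc_le not_le One_nat_def)
    with g0 show False by simp
  qed
  \<comment> \<open>The coefficients strictly between \<open>E\<close> and \<open>k\<close> are
    those that the assumption makes divisible by \<open>q\<close>.\<close>
  define E where "E = N + M - l"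
  define P where "P = (\<Sum>u\<le>E. monom (coeff ?g u) u)"
  have cP: "coeff P u = (if u \<le> E then coeff ?g u else 0)" for u
    unfolding P_def by (simp add: coeff_sum)
  define L where "L = of_nat N * [:1, 1:] + of_nat M * [:-1, 1 :: int:]"
  define V where "V = pderiv P * [:-1, 0, 1:] - L * P"
  have coV: "coeff (pderiv R * [:-1, 0, 1:] - L * R) u =
     (case u of 0 \<Rightarrow> 0 | Suc s \<Rightarrow> (int s - int N - int M) * coeff R s)
     + (int M - int N) * coeff R u - int (Suc u) * coeff R (Suc u)" for R :: "int poly" and u
    by (cases u rule: nat.exhaust; cases "u - 1")
      (auto simp: L_def mult.commute[of "pderiv R"] coeff_pderiv coeff_pCons of_nat_poly algebra_simps
         split: nat.split)
  have "int q dvd coeff V u" for u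
  proof (cases "u \<le> Suc E")
    case False
    then show ?thesis unfolding V_def coV by (auto simp: cP split: nat.split)
  next
    case True
    have van': "int q dvd coeff ?g s" if "E < s" "s < k" for s
    proof (cases "s \<le> N + M")
      case True
      have "N + M - s < l" "s + (N + M - s) = N + M"
        using that True lD unfolding E_def by auto
      then show ?thesis using van that(2) unfolding kp_vanish_def by blast
    qed (simp add: coeff_eq_0)
    \<comment> \<open>By \<open>d\<close>, \<open>k\<close> is at least \<open>E + 3\<close>, so the
      gap contains \<open>E + 1\<close> and \<open>E + 2\<close>, as far as the three-term
      recurrence looks.\<close>
    have "int q dvd coeff (?g - P) s" if "s \<le> Suc u" for s
      using van'[of s] that True d lD by (auto simp: cP E_def)
    then have "int q dvd coeff (pderiv (?g - P) * [:-1, 0, 1:] - L * (?g - P)) u"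
      unfolding coV by (auto split: nat.split intro!: dvd_add dvd_diff dvd_mult)
    moreover have "pderiv (?g - P) * [:-1, 0, 1:] - L * (?g - P) = - V"
      using kp_ode[of N M] unfolding V_def L_def by (simp only: pderiv_diff ring_distribs)
    ultimately have "int q dvd coeff (- V) u" by (simp only:)
    then show ?thesis by simp
  qed
  then have "[:int q:] dvd V" by (simp add: const_poly_dvd_iff)
  then have "[:int q:] dvd pcompose V [:-1, 1:]"
    by (metis dvd_def pcompose_const pcompose_mult)
  moreover define T where "T = pcompose P [:-1, 1:]"
  have "pcompose V [:-1, 1:] = pderiv T * [:0, -2, 1:] - (of_nat N * [:0, 1:] + of_nat M * [:-2, 1:]) * T"
  proof -
    have "pcompose [:-1, 0, 1:] [:-1, 1:] = [:0, -2, 1 :: int:]"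
      "pcompose [:1, 1:] [:-1, 1:] = [:0, 1 :: int:]" "pcompose [:-1, 1:] [:-1, 1:] = [:-2, 1 :: int:]"
      "pcompose (of_nat n) [:-1, 1:] = (of_nat n :: int poly)" for n
      by (simp_all add: pcompose_pCons of_nat_poly)
    moreover have "pderiv T = pcompose (pderiv P) [:-1, 1:]"
      by (simp add: T_def pderiv_pcompose pderiv_pCons)
    ultimately show ?thesis
      unfolding V_def T_def L_def by (simp only: pcompose_diff pcompose_mult pcompose_add)
  qed
  ultimately have rec: "int q dvd 2 * (int M - int r) * coeff T r
     - (case r of 0 \<Rightarrow> 0 | Suc s \<Rightarrow> (int N + int M - int s) * coeff T s)" for r
    unfolding coeff_ode[symmetric] by (simp only: const_poly_dvd_iff)
  \<comment> \<open>The recurrence is run upward from 0 below \<open>M\<close>, where the factor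
    \<open>M - r\<close> is a unit modulo \<open>q\<close>, and downward from \<open>E\<close> to
    \<open>M\<close>, where \<open>N + M - r\<close> lies between \<open>l\<close> and
    \<open>N\<close>.\<close>
  have dT: "coeff T r = 0" if "r > E" for r
  proof -
    have "degree P \<le> E" by (rule degree_le) (simp add: cP)
    then have "degree T \<le> E" by (simp add: T_def degree_pcompose)
    then show ?thesis using that by (simp add: coeff_eq_0)
  qed
  have low: "int q dvd coeff T r" if "r < M" for r
    using that
  proof (induction r)
    case 0
    have "int q dvd 2 * int M * coeff T 0" using rec[of 0] by simp
    moreover have "\<not> int q dvd 2 * int M"
      using q2 M 0 pq by (auto simp: prime_dvd_mult_iff dest!: zdvd_imp_le)
    ultimately show ?case using pq by (simp add: prime_dvd_mult_iff)
  next
    case (Suc r)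
    then have "int q dvd (int N + int M - int r) * coeff T r" by simp
    then have "int q dvd 2 * (int M - int (Suc r)) * coeff T (Suc r)"
      using rec[of "Suc r"] by (simp add: dvd_diff_left_iff)
    moreover have "\<not> int q dvd 2 * (int M - int (Suc r))"
    proof
      assume "int q dvd 2 * (int M - int (Suc r))"
      then have "int q dvd 2 \<or> int q dvd int M - int (Suc r)"
        using pq prime_dvd_mult_iff by blast
      then show False using q2 M Suc.prems by (auto dest!: zdvd_imp_le)
    qed
    ultimately show ?case using pq by (simp add: prime_dvd_mult_iff)
  qed
  have high: "int q dvd coeff T r" if "r \<ge> M" for r
    using that
  proof (induction "Suc E - r" arbitrary: r)
    case 0
    then show ?case by (simp add: dT)
  next
    case (Suc n)
    then have "int q dvd coeff T (Suc r)" by simp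
    then have "int q dvd (int N + int M - int r) * coeff T r"
      using rec[of "Suc r"] by (simp add: dvd_diff_right_iff)
    moreover have "int N + int M - int r = int (N + M - r)"
      using Suc.hyps(2) lD E_def by auto
    ultimately have "int q dvd int (N + M - r) * coeff T r" by (simp only:)
    then have "int q dvd int (N + M - r) \<or> int q dvd coeff T r"
      using pq prime_dvd_mult_iff by blast
    moreover have "\<not> q dvd N + M - r"
      using Suc.hyps(2) Suc.prems lD E_def by (intro N) auto
    ultimately show ?case by auto
  qed
  have "int q dvd poly T 1"
    unfolding poly_altdef using low high by (intro dvd_sum dvd_mult2) (meson not_le)
  moreover have "poly T 1 = coeff ?g 0"
    by (simp add: T_def poly_pcompose poly_0_coeff_0 cP)
  ultimately show False using g0 by simp
qed

text \<open>Cauchy-Davenport for \<open>s = 0\<close>, the bound \<open>k + l - 2 s\<close>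
  otherwise, and the Erdos-Heilbronn exception \<open>k + l - 3\<close> for \<open>s = 1\<close> and
  equal sizes.\<close>

definition sumset_bound :: "nat \<Rightarrow> nat \<Rightarrow> nat \<Rightarrow> nat \<Rightarrow> bool" where
  "sumset_bound k l s M \<longleftrightarrow>
     s = 0 \<and> k + l \<le> M + 1 \<or> s \<ge> 1 \<and> k + l \<le> M + 2 * s \<or> s = 1 \<and> k = l \<and> k + l \<le> M + 3"

lemma coeff_kp_0: "coeff (kp 0 m) u = int (m choose u)"
proof (cases "u \<le> m")
  case True
  then show ?thesis by (simp add: kp_def coeff_linear_poly_power)
qed (simp add: kp_def coeff_eq_0 degree_power_eq)

lemma coeff_kp_1: "coeff (kp 1 m) u = (case u of 0 \<Rightarrow> 0 | Suc v \<Rightarrow> int (m choose v)) - int (m choose u)"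
  using kp_Suc1[of 0 m] by (simp add: coeff_kp_0 coeff_pCons split: nat.split)

lemma kp_vanish_trivial: "a + b \<le> n + m + 1 \<Longrightarrow> kp_vanish q n m a b"
  unfolding kp_vanish_def by auto

text \<open>The total degree leaves no monomial to check, except in the exceptional case, where the
  single middle coefficient is zero by symmetry. For \<open>s = 0\<close> truncated subtraction
  gives the desired exponent 0.\<close>

lemma kp_vanish_if_sumset_bound:
  assumes "sumset_bound a b s m"
  shows "kp_vanish q (2 * s - 1) m a b"
proof -
  consider "a + b \<le> (2 * s - 1) + m + 1" | "s = 1" "a = b" "a + b = m + 3"
    using assms unfolding sumset_bound_def by fastforce
  then show ?thesis
  proof cases
    case 2
    have "coeff (kp 1 m) u = 0" if "u < a" "v < b" "u + v = 1 + m" for u v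
    proof -
      have "u \<noteq> 0" "m = u - 1 + u" using 2 that by auto
      then obtain w where w: "u = Suc w" "m = w + u" by (cases u) auto
      then have "m choose w = m choose u"
        using binomial_symmetric[of w m] by simp
      then show ?thesis by (simp only: coeff_kp_1 w(1) nat.case diff_self)
    qed
    then show ?thesis unfolding kp_vanish_def using 2 by simp
  qed (rule kp_vanish_trivial)
qed

lemma prime_not_dvd_choose:
  assumes "prime (q::nat)" "m < q" "u \<le> m"
  shows "\<not> q dvd m choose u"
proof
  assume "q dvd m choose u"
  then have "q dvd fact m"
    using assms(3) by (metis binomial_fact_lemma dvd_mult)
  then show False using assms by (simp add: prime_dvd_fact_iff)
qed

text \<open>\<open>not_kp_vanish\<close> gives \<open>k + l\<close> at most
  \<open>N + M + 2\<close>, which suffices for \<open>s\<close> at least 2. For smaller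
  \<open>s\<close> this is one too weak, and equality is settled by the one coefficient
  left.\<close>

lemma sumset_bound_if_kp_vanish:
  assumes q: "prime q" "odd q" and M: "M < q" and kl: "k \<ge> 1" "l \<ge> 1"
    and van: "kp_vanish q N M k l"
    and N: "s \<le> 1 \<Longrightarrow> N = s" "s \<ge> 2 \<Longrightarrow> N + 2 \<le> 2 * s" "N < q"
  shows "sumset_bound k l s M"
proof -
  have Nr: "\<not> q dvd r" if "l \<le> r" "r \<le> N" for r
    using that N(3) kl by (auto dest: dvd_imp_le)
  have b: "k + l \<le> N + M + 2"
  proof (rule ccontr)
    assume "\<not> k + l \<le> N + M + 2"
    then have "\<not> kp_vanish q N M k l" using Nr by (intro not_kp_vanish q M kl) auto
    with van show False by simp
  qed
  consider "s = 0" | "s = 1" | "s \<ge> 2" by linarith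
  then show ?thesis
  proof cases
    case 1
    have False if "k + l = M + 2"
    proof -
      have "int q dvd coeff (kp 0 M) (k - 1)"
        using van[unfolded kp_vanish_def, rule_format, of "k - 1" "l - 1"] N(1) 1 kl that by simp
      moreover have "k - 1 \<le> M" using kl that by simp
      ultimately show False using prime_not_dvd_choose[OF q(1) M] by (simp add: coeff_kp_0)
    qed
    then show ?thesis using b N(1) 1 unfolding sumset_bound_def by fastforce
  next
    case 2
    have "k = l" if kl3: "k + l = M + 3"
    proof (rule ccontr)
      assume ne: "k \<noteq> l"
      have "k - 1 < k" "l - 1 < l" "k - 1 + (l - 1) = 1 + M" using kl kl3 by auto
      then have d: "int q dvd coeff (kp 1 M) (k - 1)"
        using van[unfolded kp_vanish_def, rule_format, of "k - 1" "l - 1"] N(1) 2 by simp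
      show False
      proof (cases "k = 1 \<or> l = 1")
        case True
        then have "k - 1 = 0 \<or> k - 1 = Suc M" using kl3 by auto
        then have "coeff (kp 1 M) (k - 1) = -1 \<or> coeff (kp 1 M) (k - 1) = 1"
          unfolding coeff_kp_1 by auto
        then show False using d q(1) by auto
      next
        case False
        then obtain u where u: "k = u + 2" "u \<le> M" "l = M + 1 - u" "u < M"
          using kl kl3 by (intro that[of "k - 2"]) auto
        \<comment> \<open>The factor \<open>Suc u\<close> turns the difference of neighbouring
          binomials into one binomial times \<open>k - l\<close>.\<close>
        have "int q dvd int (Suc u) * (int (M choose u) - int (M choose Suc u))"
          using d u by (simp add: coeff_kp_1[unfolded One_nat_def])
        also have "int (Suc u) * (int (M choose u) - int (M choose Suc u))
            = int (M choose u) * (int k - int l)"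
        proof -
          have "Suc u * (M choose Suc u) = (M choose u) * (M - u)"
            by (simp only: binomial_absorption flip: binomial_absorb_comp) (simp only: mult.commute)
          then have "int (Suc u) * int (M choose Suc u) = int (M choose u) * (int M - int u)"
            using u(2) by (metis of_nat_diff of_nat_mult)
          then show ?thesis using u by (simp add: algebra_simps of_nat_diff)
        qed
        finally have "int q dvd int (M choose u) \<or> int q dvd int k - int l"
          using q(1) prime_dvd_mult_iff[of "int q"] by auto
        then have "int q dvd int k - int l"
          using prime_not_dvd_choose[OF q(1) M u(2)] by simp
        moreover have "\<bar>int k - int l\<bar> < int q" using u M by auto
        ultimately show False using ne by (metis dvd_imp_le_int eq_iff_diff_eq_0 not_le of_nat_eq_iff abs_of_nat)
      qed
    qed
    then show ?thesis using b N(1) 2 unfolding sumset_bound_def by fastforce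
  next
    case 3
    then show ?thesis using b N(2) unfolding sumset_bound_def by auto
  qed
qed

section \<open>Cosets in a finite abelian group\<close>

primrec nat_mult :: "nat \<Rightarrow> 'a::ab_group_add \<Rightarrow> 'a" where
  "nat_mult 0 g = 0"
| "nat_mult (Suc n) g = g + nat_mult n g"

lemma nat_mult_add: "nat_mult (m + n) g = nat_mult m g + nat_mult n g"
  by (induction m) (simp_all add: add_ac)

lemma nat_mult_mult: "nat_mult (m * n) g = nat_mult m (nat_mult n g)"
  by (induction m) (simp_all add: nat_mult_add)

lemma nat_mult_diff: "nat_mult n (g - h) = nat_mult n g - nat_mult n h"
  by (induction n) (simp_all add: algebra_simps)

lemma nat_mult_zero [simp]: "nat_mult n 0 = 0"
  by (induction n) simp_all

lemma nat_mult_one [simp]: "nat_mult (Suc 0) g = g"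
  by simp

text \<open>Translation by \<open>g\<close> permutes the group, so it preserves the sum of all
  elements.\<close>

lemma nat_mult_card_UNIV: "nat_mult (card (UNIV :: 'a set)) (g :: 'a::{finite, ab_group_add}) = 0"
proof -
  have s: "(\<Sum>h\<in>A. g) = nat_mult (card A) g" if "finite A" for A :: "'a set"
    using that by (induction A) auto
  have "(\<Sum>h\<in>UNIV. h) = (\<Sum>h\<in>UNIV. g + h)"
    by (rule sum.reindex_bij_witness[of _ "\<lambda>h. g + h" "\<lambda>h. h - g"]) auto
  also have "\<dots> = nat_mult (card (UNIV :: 'a set)) g + (\<Sum>h\<in>UNIV. h)"
    by (simp add: sum.distrib s)
  finally show ?thesis by simp
qed

definition subgrp :: "'a::ab_group_add set \<Rightarrow> bool" where
  "subgrp H \<longleftrightarrow> 0 \<in> H \<and> (\<forall>x\<in>H. \<forall>y\<in>H. x - y \<in> H)"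

lemma subgrp_zero: "subgrp H \<Longrightarrow> 0 \<in> H"
  by (simp add: subgrp_def)

lemma subgrp_diff: "subgrp H \<Longrightarrow> x \<in> H \<Longrightarrow> y \<in> H \<Longrightarrow> x - y \<in> H"
  by (simp add: subgrp_def)

lemma subgrp_minus: "subgrp H \<Longrightarrow> x \<in> H \<Longrightarrow> - x \<in> H"
  using subgrp_diff[of H 0 x] by (simp add: subgrp_zero)

lemma subgrp_add: "subgrp H \<Longrightarrow> x \<in> H \<Longrightarrow> y \<in> H \<Longrightarrow> x + y \<in> H"
  using subgrp_diff[of H x "- y"] by (simp add: subgrp_minus)

lemma subgrp_nat_mult: "subgrp H \<Longrightarrow> x \<in> H \<Longrightarrow> nat_mult n x \<in> H"
  by (induction n) (auto simp: subgrp_zero subgrp_add)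

lemma subgrp_nat_mult_gcd:
  assumes "subgrp H" "nat_mult a g \<in> H" "nat_mult b g \<in> H"
  shows "nat_mult (gcd a b) g \<in> H"
proof (cases "a = 0")
  case False
  then obtain x y where "a * x = b * y + gcd a b" using bezout_nat by blast
  then have "nat_mult (gcd a b) g = nat_mult x (nat_mult a g) - nat_mult y (nat_mult b g)"
    by (metis add_diff_cancel_left' nat_mult_add nat_mult_mult mult.commute)
  then show ?thesis using assms by (simp add: subgrp_diff subgrp_nat_mult)
qed (use assms in simp)

lemma subgrp_nat_mult_coprime:
  assumes "subgrp H" "nat_mult a g \<in> H" "nat_mult b g \<in> H" "coprime a b"
  shows "g \<in> H"
  using subgrp_nat_mult_gcd[OF assms(1-3)] assms(4) by simp

definition coset :: "'a::ab_group_add \<Rightarrow> 'a set \<Rightarrow> 'a set" where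
  "coset x H = {z. z - x \<in> H}"

lemma coset_self: "subgrp H \<Longrightarrow> x \<in> coset x H"
  by (simp add: coset_def subgrp_zero)

lemma coset_cong:
  assumes "subgrp H" "x - y \<in> H"
  shows "coset x H = coset y H"
proof -
  have "z - x \<in> H \<longleftrightarrow> z - y \<in> H" for z
    using subgrp_add[OF assms(1) _ assms(2), of "z - x"] subgrp_diff[OF assms(1) _ assms(2), of "z - y"]
    by auto
  then show ?thesis by (simp add: coset_def)
qed

lemma coset_disjoint:
  assumes "subgrp H" "x - y \<notin> H"
  shows "coset x H \<inter> coset y H = {}"
proof -
  have "x - y \<in> H" if "z \<in> coset x H" "z \<in> coset y H" for z
    using that subgrp_diff[OF assms(1), of "z - y" "z - x"] by (simp add: coset_def)
  then show ?thesis using assms(2) by blast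
qed

lemma coset_add: "subgrp H \<Longrightarrow> a \<in> coset x H \<Longrightarrow> b \<in> coset y H \<Longrightarrow> a + b \<in> coset (x + y) H"
  unfolding coset_def using subgrp_add[of H "a - x" "b - y"] by (simp add: algebra_simps)

lemma coset_diff: "subgrp H \<Longrightarrow> a \<in> coset x H \<Longrightarrow> b \<in> coset y H \<Longrightarrow> a - b \<in> coset (x - y) H"
  unfolding coset_def using subgrp_diff[of H "a - x" "b - y"] by (simp add: algebra_simps)

section \<open>Extensions of index \<open>q\<close> and transfer of the fibre condition along
  them\<close>

definition adjoin :: "nat \<Rightarrow> 'a::ab_group_add \<Rightarrow> 'a set \<Rightarrow> 'a set" where
  "adjoin q g H = {z. \<exists>t<q. z - nat_mult t g \<in> H}"

lemma nat_mult_mod: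
  assumes "subgrp H" "nat_mult q g \<in> H"
  shows "nat_mult s g - nat_mult (s mod q) g \<in> H"
proof -
  have "nat_mult s g = nat_mult (s mod q) g + nat_mult (s div q) (nat_mult q g)"
    by (metis mod_div_mult_eq nat_mult_add nat_mult_mult)
  then show ?thesis using assms by (simp add: subgrp_nat_mult)
qed

lemma subgrp_adjoin:
  assumes "subgrp H" "nat_mult q g \<in> H" "q > 0"
  shows "subgrp (adjoin q g H)"
  unfolding subgrp_def
proof (intro conjI ballI)
  show "0 \<in> adjoin q g H"
    unfolding adjoin_def using assms by (auto intro!: exI[of _ 0] simp: subgrp_zero)
  fix x y assume "x \<in> adjoin q g H" "y \<in> adjoin q g H"
  then obtain s t where st: "s < q" "t < q" "x - nat_mult s g \<in> H" "y - nat_mult t g \<in> H"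
    unfolding adjoin_def by auto
  let ?u = "(s + q - t) mod q"
  have "nat_mult (s + q - t) g + nat_mult t g = nat_mult s g + nat_mult q g"
    using st by (simp flip: nat_mult_add)
  then have "x - y - nat_mult ?u g = (x - nat_mult s g) - (y - nat_mult t g) - nat_mult q g
      + (nat_mult (s + q - t) g - nat_mult ?u g)"
    by (simp add: algebra_simps)
  moreover have "\<dots> \<in> H"
    by (rule subgrp_add[OF assms(1) subgrp_diff[OF assms(1) subgrp_diff[OF assms(1) st(3,4)] assms(2)]
          nat_mult_mod[OF assms(1,2)]])
  ultimately have "x - y - nat_mult ?u g \<in> H" by (simp only:)
  moreover have "?u < q" using assms(3) by simp
  ultimately show "x - y \<in> adjoin q g H" unfolding adjoin_def by blast
qed

text \<open>The \<open>q\<close> cosets are disjoint: otherwise a multiple of \<open>g\<close>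
  coprime to \<open>q\<close> would lie in \<open>H\<close>, and with it \<open>g\<close>.\<close>

lemma sum_coset_adjoin:
  fixes f :: "'a::{finite, ab_group_add} \<Rightarrow> nat"
  assumes H: "subgrp H" and q: "prime q" and g: "g \<notin> H" "nat_mult q g \<in> H"
  shows "sum f (coset x (adjoin q g H)) = (\<Sum>t<q. sum f (coset (x + nat_mult t g) H))"
proof -
  have "coset x (adjoin q g H) = (\<Union>t<q. coset (x + nat_mult t g) H)"
    by (auto simp: coset_def adjoin_def algebra_simps)
  moreover have "coset (x + nat_mult s g) H \<inter> coset (x + nat_mult t g) H = {}"
    if "s < q" "t < q" "s \<noteq> t" for s t
  proof -
    have *: "nat_mult s g - nat_mult t g \<notin> H" if "t < s" "s < q" for s t
    proof
      assume "nat_mult s g - nat_mult t g \<in> H"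
      moreover have "nat_mult s g = nat_mult (s - t) g + nat_mult t g"
        using that by (simp flip: nat_mult_add)
      ultimately have "nat_mult (s - t) g \<in> H" by simp
      moreover have "coprime (s - t) q"
        using q that by (metis coprime_commute dvd_imp_le less_imp_diff_less not_le prime_imp_coprime zero_less_diff)
      ultimately show False using subgrp_nat_mult_coprime[OF H _ g(2)] g(1) by blast
    qed
    have "nat_mult s g - nat_mult t g \<notin> H"
      using *[of t s] *[of s t] that subgrp_minus[OF H, of "nat_mult s g - nat_mult t g"]
      by (metis linorder_neqE_nat minus_diff_eq)
    then show ?thesis by (intro coset_disjoint[OF H]) simp
  qed
  ultimately show ?thesis by (simp add: sum.UNION_disjoint)
qed

text \<open>Weight functions replace sets because the weight on \<open>S\<close> is not an
  indicator.\<close>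

definition coset_vanish :: "nat \<Rightarrow> ('a::{finite, ab_group_add} \<Rightarrow> nat) \<Rightarrow> ('a \<Rightarrow> nat) \<Rightarrow> ('a \<Rightarrow> nat) \<Rightarrow> ('a \<Rightarrow> nat) \<Rightarrow> 'a set \<Rightarrow> bool" where
  "coset_vanish q w m a b H \<longleftrightarrow>
     (\<forall>x y. kp_vanish q (sum w (coset (x - y) H)) (sum m (coset (x + y) H))
              (sum a (coset x H)) (sum b (coset y H)))"

text \<open>\<open>kp_vanish_sum\<close> with the cosets of multiples of \<open>g\<close> as
  residues; reducing the multiples modulo \<open>q\<close> is harmless since
  \<open>nat_mult q g\<close> lies in \<open>H\<close>.\<close>

lemma coset_vanish_adjoin:
  assumes H: "subgrp H" and q: "prime q" and g: "g \<notin> H" "nat_mult q g \<in> H"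
    and van: "coset_vanish q w m a b H"
  shows "coset_vanish q w m a b (adjoin q g H)"
  unfolding coset_vanish_def sum_coset_adjoin[OF H q g]
proof (intro allI kp_vanish_sum[OF q])
  fix x y i j assume ij: "i < q" "j < q"
  let ?d = "(i + q - j) mod q" and ?c = "(i + j) mod q"
  have "nat_mult (i + q - j) g + nat_mult j g = nat_mult i g + nat_mult q g"
    using ij by (simp flip: nat_mult_add)
  then have "x - y + nat_mult ?d g - (x + nat_mult i g - (y + nat_mult j g))
      = nat_mult q g - (nat_mult (i + q - j) g - nat_mult ?d g)"
    by (simp add: algebra_simps)
  also have "\<dots> \<in> H" by (rule subgrp_diff[OF H g(2) nat_mult_mod[OF H g(2)]])
  finally have 1: "coset (x - y + nat_mult ?d g) H = coset (x + nat_mult i g - (y + nat_mult j g)) H"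
    by (rule coset_cong[OF H])
  have "x + nat_mult i g + (y + nat_mult j g) - (x + y + nat_mult ?c g)
      = nat_mult (i + j) g - nat_mult ?c g"
    by (simp add: nat_mult_add algebra_simps)
  also have "\<dots> \<in> H" using nat_mult_mod[OF H g(2)] .
  finally have 2: "coset (x + nat_mult i g + (y + nat_mult j g)) H = coset (x + y + nat_mult ?c g) H"
    by (rule coset_cong[OF H])
  show "kp_vanish q (sum w (coset (x - y + nat_mult ?d g) H)) (sum m (coset (x + y + nat_mult ?c g) H))
    (sum a (coset (x + nat_mult i g) H)) (sum b (coset (y + nat_mult j g) H))"
    unfolding 1 2[symmetric] using van unfolding coset_vanish_def by blast
qed

text \<open>The quotient of \<open>K\<close> by \<open>H\<close> is a \<open>q\<close>-group, so
  \<open>K\<close> is reached by successive extensions of index \<open>q\<close>.\<close>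

lemma coset_vanish_mono:
  fixes H K :: "'a::{finite, ab_group_add} set"
  assumes "subgrp H" "subgrp K" "H \<subseteq> K" "prime q" "\<And>g. g \<in> K \<Longrightarrow> \<exists>e. nat_mult (q ^ e) g \<in> H"
    and "coset_vanish q w m a b H"
  shows "coset_vanish q w m a b K"
  using assms(1,3,5,6)
proof (induction "card K - card H" arbitrary: H rule: less_induct)
  case less
  show ?case
  proof (cases "H = K")
    case False
    then obtain g0 where g0: "g0 \<in> K" "g0 \<notin> H" using less.prems(2) by auto
    \<comment> \<open>By minimality of \<open>e\<close>, the multiple of \<open>g0\<close> by
      \<open>q ^ (e - 1)\<close> is outside \<open>H\<close> while its \<open>q\<close>-fold is
      inside.\<close>
    define e where "e = (LEAST e. nat_mult (q ^ e) g0 \<in> H)"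
    have e: "nat_mult (q ^ e) g0 \<in> H"
      unfolding e_def using less.prems(3)[OF g0(1)] by (rule LeastI_ex)
    then have "e \<noteq> 0" using g0 by (metis nat_mult_one power_0 One_nat_def)
    then obtain d where d: "e = Suc d" using not0_implies_Suc by blast
    define g where "g = nat_mult (q ^ d) g0"
    have g: "g \<notin> H" "nat_mult q g \<in> H" "g \<in> K"
    proof -
      show "g \<notin> H" unfolding g_def using not_less_Least[of d "\<lambda>e. nat_mult (q ^ e) g0 \<in> H"] d e_def by auto
      show "nat_mult q g \<in> H" using e unfolding g_def d by (simp add: nat_mult_mult)
      show "g \<in> K" unfolding g_def using assms(2) g0 by (simp add: subgrp_nat_mult)
    qed
    have q: "q > 1" using assms(4) by (rule prime_gt_1_nat)
    let ?H = "adjoin q g H"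
    have HH: "H \<subseteq> ?H" unfolding adjoin_def using q by (auto intro!: exI[of _ 0])
    moreover have "g \<in> ?H" unfolding adjoin_def using q less.prems(1) by (auto intro!: exI[of _ 1] simp: subgrp_zero)
    ultimately have "card H < card ?H" using g by (intro psubset_card_mono) auto
    moreover have HK: "?H \<subseteq> K"
    proof
      fix z assume "z \<in> ?H"
      then obtain t where "z - nat_mult t g \<in> H" unfolding adjoin_def by auto
      then have "(z - nat_mult t g) + nat_mult t g \<in> K"
        using less.prems(2) g assms(2) by (intro subgrp_add subgrp_nat_mult) auto
      then show "z \<in> K" by simp
    qed
    ultimately have "card K - card ?H < card K - card H"
      using card_mono[OF _ HK] by simp
    moreover have "subgrp ?H"
      using less.prems(1) g(2) q by (intro subgrp_adjoin) auto
    moreover have "coset_vanish q w m a b ?H"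
      by (rule coset_vanish_adjoin[OF less.prems(1) assms(4) g(1,2) less.prems(4)])
    moreover have "\<exists>e. nat_mult (q ^ e) g \<in> ?H" if "g \<in> K" for g
      using less.prems(3)[OF that] HH by blast
    ultimately show ?thesis using HK less.hyps[of ?H] by blast
  qed (use less.prems in simp)
qed

text \<open>The subgroup is the \<open>q'\<close>-part of \<open>H\<close>, for a prime \<open>q\<close> dividing the order of \<open>z\<close>.\<close>
lemma separating_subgroup:
  fixes H :: "'a::{finite, ab_group_add} set"
  assumes H: "subgrp H" and z: "z \<in> H" "z \<noteq> 0"
  obtains q K where "prime q" "q dvd card (UNIV :: 'a set)" "subgrp K" "K \<subseteq> H" "z \<notin> K"
    "\<And>g. g \<in> H \<Longrightarrow> \<exists>e. nat_mult (q ^ e) g \<in> K"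
proof -
  let ?c = "card (UNIV :: 'a set)"
  have c: "?c > 0" by (simp add: finite_UNIV_card_ge_0)
  define n where "n = (LEAST n. n > 0 \<and> nat_mult n z = 0)"
  have n: "n > 0 \<and> nat_mult n z = 0"
    unfolding n_def by (rule LeastI[of _ ?c]) (use c nat_mult_card_UNIV in blast)
  have sg0: "subgrp {0 :: 'a}" by (simp add: subgrp_def)
  have dvd: "n dvd k" if "nat_mult k z = 0" for k
  proof -
    have "nat_mult (gcd n k) z = 0"
      using subgrp_nat_mult_gcd[OF sg0, of n z k] n that by simp
    moreover have "gcd n k > 0" using n by simp
    ultimately have "n \<le> gcd n k" unfolding n_def by (intro Least_le) auto
    then have "gcd n k = n" using n by (simp add: gcd_le1_nat le_antisym)
    then show ?thesis by (metis gcd_dvd2)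
  qed
  have "n \<noteq> 1" using n z by auto
  then obtain q where q: "prime q" "q dvd n" using prime_factor_nat by blast
  define K where "K = {g \<in> H. \<exists>k. coprime k q \<and> nat_mult k g = 0}"
  have "prime q" by fact
  moreover have "q dvd ?c" by (rule dvd_trans[OF q(2) dvd[OF nat_mult_card_UNIV]])
  moreover have "subgrp K"
    unfolding subgrp_def
  proof (intro conjI ballI)
    show "0 \<in> K" unfolding K_def using H by (auto simp: subgrp_zero intro!: exI[of _ 1])
    fix g h assume gh: "g \<in> K" "h \<in> K"
    then obtain k l where "coprime k q" "nat_mult k g = 0" "coprime l q" "nat_mult l h = 0"
      unfolding K_def by auto
    then have "coprime (k * l) q \<and> nat_mult (k * l) (g - h) = 0"
      by (simp add: nat_mult_diff nat_mult_mult) (metis mult.commute nat_mult_mult nat_mult_zero)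
    then show "g - h \<in> K" using gh subgrp_diff[OF H] unfolding K_def by blast
  qed
  moreover have "K \<subseteq> H" by (auto simp: K_def)
  moreover have "z \<notin> K"
  proof
    assume "z \<in> K"
    then obtain k where k: "coprime k q" "nat_mult k z = 0" unfolding K_def by auto
    then have "q dvd k" using dvd q by (meson dvd_trans)
    then show False using k q by (meson coprime_common_divisor dvd_refl not_prime_unit)
  qed
  moreover have "\<exists>e. nat_mult (q ^ e) g \<in> K" if "g \<in> H" for g
  proof -
    \<comment> \<open>Multiplication by the \<open>q\<close>-part of the group order leaves an
      element annihilated by the cofactor, which is prime to \<open>q\<close>.\<close>
    obtain k where k: "?c = q ^ multiplicity q ?c * k" "\<not> q dvd k"
      using multiplicity_decompose'[of ?c q] c q by (metis neq0_conv not_prime_unit)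
    have "nat_mult k (nat_mult (q ^ multiplicity q ?c) g) = 0"
      by (metis k(1) mult.commute nat_mult_card_UNIV nat_mult_mult)
    moreover have "coprime k q" using k q by (metis coprime_commute prime_imp_coprime)
    ultimately show ?thesis using subgrp_nat_mult[OF H that] unfolding K_def by blast
  qed
  ultimately show ?thesis by (rule that)
qed

section \<open>Restricted sumsets\<close>

lemma sum_of_bool_card: "finite D \<Longrightarrow> (\<Sum>g\<in>D. of_bool (g \<in> A)) = card (A \<inter> D)"
  by (simp add: of_bool_def sum.If_cases Int_commute)

text \<open>Each \<open>K\<close>-coset \<open>D\<close> meeting \<open>S\<close> gets total weight \<open>2 * card (S \<inter> D) - 1\<close>: every point of
  \<open>S\<close> has weight \<open>2\<close>, except for one representative of each coset.\<close>
lemma kp_vanish_assemble: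
  fixes A B C S H K :: "'a::{finite, ab_group_add} set"
  assumes H: "subgrp H" and K: "subgrp K" "K \<subseteq> H" and q: "prime q"
    and pw: "\<And>g. g \<in> H \<Longrightarrow> \<exists>e. nat_mult (q ^ e) g \<in> K"
    and sub: "A \<subseteq> coset x H" "B \<subseteq> coset y H" "S \<subseteq> coset (x - y) H" "C \<subseteq> coset (x + y) H"
    and loc: "\<And>u v. A \<inter> coset u K \<noteq> {} \<Longrightarrow> B \<inter> coset v K \<noteq> {} \<Longrightarrow>
      kp_vanish q (2 * card (S \<inter> coset (u - v) K) - 1) (card (C \<inter> coset (u + v) K))
        (card (A \<inter> coset u K)) (card (B \<inter> coset v K))"
  shows "\<exists>N. (card S \<le> 1 \<longrightarrow> N = card S) \<and>
    (\<forall>s\<in>S. \<forall>s'\<in>S. s - s' \<notin> K \<longrightarrow> N + 2 \<le> 2 * card S) \<and>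
    kp_vanish q N (card C) (card A) (card B)"
proof -
  define rep where "rep D = (SOME g. g \<in> S \<inter> D)" for D
  have rep: "rep D \<in> S \<inter> D" if "S \<inter> D \<noteq> {}" for D
    unfolding rep_def using someI_ex[of "\<lambda>g. g \<in> S \<inter> D"] that by blast
  define R where "R = (\<lambda>d. rep (coset d K)) ` S"
  have rS: "rep (coset d K) \<in> S \<inter> coset d K" if "d \<in> S" for d
    using that coset_self[OF K(1)] by (intro rep) auto
  have RS: "R \<subseteq> S" unfolding R_def using rS by auto
  define w :: "'a \<Rightarrow> nat" where "w g = (if g \<in> R then 1 else if g \<in> S then 2 else 0)" for g
  have w: "sum w D + card (R \<inter> D) = 2 * card (S \<inter> D)" for D
  proof -
    have "w g + of_bool (g \<in> R) = 2 * of_bool (g \<in> S)" for g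
      using RS by (auto simp: w_def)
    then have "(\<Sum>g\<in>D. w g + of_bool (g \<in> R)) = (\<Sum>g\<in>D. 2 * of_bool (g \<in> S))" by simp
    then show ?thesis
      by (simp add: sum.distrib sum_of_bool_card Int_commute flip: sum_distrib_left)
  qed
  have wK: "sum w (coset d K) = 2 * card (S \<inter> coset d K) - 1" for d
  proof (cases "S \<inter> coset d K = {}")
    case True
    then show ?thesis using w[of "coset d K"] by simp
  next
    case False
    have 1: "coset g K = coset d K" if "g \<in> coset d K" for g
      using that K by (intro coset_cong) (auto simp: coset_def)
    have 2: "g \<in> coset d K" if "rep (coset g K) \<in> coset d K" "g \<in> S" for g
    proof -
      have "g - d \<in> K"
        using coset_disjoint[OF K(1), of g d] rS[OF that(2)] that(1) by blast
      then show ?thesis by (simp add: coset_def)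
    qed
    have "R \<inter> coset d K = {rep (coset d K)}"
    proof (intro equalityI subsetI)
      fix r assume "r \<in> R \<inter> coset d K"
      then obtain g where g: "g \<in> S" "r = rep (coset g K)" "r \<in> coset d K"
        unfolding R_def by blast
      then have "coset g K = coset d K" by (intro 1[OF 2]) simp_all
      then show "r \<in> {rep (coset d K)}" using g by simp
    next
      fix r assume r: "r \<in> {rep (coset d K)}"
      then have "r \<in> S \<inter> coset d K" using rep[OF False] by simp
      moreover have "r = rep (coset r K)" using r 1[of r] calculation by simp
      ultimately show "r \<in> R \<inter> coset d K" unfolding R_def by blast
    qed
    then show ?thesis using w[of "coset d K"] by simp
  qed
  have w0: "w g = 0" if "g \<notin> S" for g using that RS by (auto simp: w_def)
  have wH: "sum w (coset (x - y) H) = sum w S"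
    using sub(3) w0 by (intro sum.mono_neutral_right) auto
  define ind where "ind X = (\<lambda>g. of_bool (g \<in> X) :: nat)" for X :: "'a set"
  have ind: "sum (ind X) D = card (X \<inter> D)" for X D
    by (simp only: ind_def sum_of_bool_card[OF finite])
  have "coset_vanish q w (ind C) (ind A) (ind B) K"
    unfolding coset_vanish_def ind wK
  proof (intro allI)
    fix u v
    \<comment> \<open>If a fibre of \<open>A\<close> or \<open>B\<close> is empty, the condition is
      vacuous.\<close>
    show "kp_vanish q (2 * card (S \<inter> coset (u - v) K) - 1) (card (C \<inter> coset (u + v) K))
        (card (A \<inter> coset u K)) (card (B \<inter> coset v K))"
      using loc[of u v] by (cases "A \<inter> coset u K = {} \<or> B \<inter> coset v K = {}")
        (auto simp: kp_vanish_def)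
  qed
  then have "coset_vanish q w (ind C) (ind A) (ind B) H"
    using coset_vanish_mono[OF K(1) H K(2) q pw] by blast
  then have van: "kp_vanish q (sum w S) (card C) (card A) (card B)"
    unfolding coset_vanish_def ind
    by (metis wH sub(1,2,4) inf.absorb1)
  have wS: "sum w S + card R = 2 * card S" using w[of S] RS by (simp add: inf.absorb1)
  have R1: "card R \<ge> 1" if "S \<noteq> {}"
    using that by (simp add: R_def Suc_le_eq card_gt_0_iff)
  show ?thesis
  proof (intro exI[of _ "sum w S"] conjI impI ballI)
    show "kp_vanish q (sum w S) (card C) (card A) (card B)" by (rule van)
    show "sum w S = card S" if "card S \<le> 1"
    proof (cases "S = {}")
      case False
      then have "card R \<le> card S" using RS by (simp add: card_mono)
      then show ?thesis using wS R1 False that by simp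
    qed simp
    fix s s' assume s: "s \<in> S" "s' \<in> S" "s - s' \<notin> K"
    \<comment> \<open>Two cosets meeting \<open>S\<close> have two representatives, each saving one
      unit of weight.\<close>
    have "rep (coset s K) \<noteq> rep (coset s' K)"
      using rS[OF s(1)] rS[OF s(2)] coset_disjoint[OF K(1) s(3)] by auto
    then have "card {rep (coset s K), rep (coset s' K)} = 2" by simp
    moreover have "card {rep (coset s K), rep (coset s' K)} \<le> card R"
      using s by (intro card_mono) (auto simp: R_def)
    ultimately show "sum w S + 2 \<le> 2 * card S" using wS by simp
  qed
qed

lemma restricted_sumset_fiber:
  assumes "subgrp K"
  shows "restricted_sumset (A \<inter> coset u K) (S \<inter> coset (u - v) K) (B \<inter> coset v K)
    \<subseteq> restricted_sumset A S B \<inter> coset (u + v) K"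
  unfolding restricted_sumset_def using coset_add[OF assms] coset_diff[OF assms] by blast

lemma restricted_sumset_coset:
  assumes "subgrp H" "A \<subseteq> coset x H" "B \<subseteq> coset y H"
  shows "restricted_sumset A S B \<subseteq> coset (x + y) H"
  unfolding restricted_sumset_def using coset_add[OF assms(1)] assms(2,3) by blast

text \<open>For one fixed \<open>b\<close>, each \<open>a\<close> either contributes the sum
  \<open>a + b\<close> or has \<open>a - b\<close> in \<open>S\<close>.\<close>

lemma card_le_restricted_sumset1:
  fixes A B S :: "'a::{finite, ab_group_add} set"
  assumes "B \<noteq> {}"
  shows "card A \<le> card (restricted_sumset A S B) + card S"
proof -
  obtain b where b: "b \<in> B" using assms by auto
  have "A \<subseteq> (\<lambda>c. c - b) ` restricted_sumset A S B \<union> (\<lambda>s. s + b) ` S"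
  proof
    fix a assume a: "a \<in> A"
    show "a \<in> (\<lambda>c. c - b) ` restricted_sumset A S B \<union> (\<lambda>s. s + b) ` S"
    proof (cases "a - b \<in> S")
      case True
      then have "a \<in> (\<lambda>s. s + b) ` S" by (intro image_eqI[of _ _ "a - b"]) auto
      then show ?thesis by simp
    next
      case False
      then have "a + b \<in> restricted_sumset A S B" using a b unfolding restricted_sumset_def by auto
      then have "a \<in> (\<lambda>c. c - b) ` restricted_sumset A S B" by (intro image_eqI[of _ _ "a + b"]) auto
      then show ?thesis by simp
    qed
  qed
  then have "card A \<le> card ((\<lambda>c. c - b) ` restricted_sumset A S B \<union> (\<lambda>s. s + b) ` S)"
    by (intro card_mono) auto
  also have "\<dots> \<le> card (restricted_sumset A S B) + card S"
    by (rule order.trans[OF card_Un_le add_mono]) (simp_all add: card_image_le)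
  finally show ?thesis .
qed

lemma restricted_sumset_commute: "restricted_sumset A S B = restricted_sumset B (uminus ` S) A"
proof -
  have 1: "b - a \<in> uminus ` S \<longleftrightarrow> a - b \<in> S" for a b
  proof
    assume "b - a \<in> uminus ` S"
    then obtain s where "s \<in> S" "b - a = - s" by auto
    then show "a - b \<in> S" by (metis minus_diff_eq minus_minus)
  qed (auto intro: image_eqI[of _ _ "a - b"])
  show ?thesis
    unfolding restricted_sumset_def 1 by (intro Collect_cong) (metis add.commute)
qed

lemma card_le_restricted_sumset2:
  fixes A B S :: "'a::{finite, ab_group_add} set"
  assumes "A \<noteq> {}"
  shows "card B \<le> card (restricted_sumset A S B) + card S"
  using card_le_restricted_sumset1[OF assms, of B "uminus ` S"] card_image_le[of S uminus]
  by (simp add: restricted_sumset_commute[of A S B])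

lemma sumset_bound_mono: "sumset_bound k l s m \<Longrightarrow> m \<le> M \<Longrightarrow> sumset_bound k l s M"
  unfolding sumset_bound_def by linarith

text \<open>The element kept out of \<open>K\<close> is a difference of two elements of
  \<open>S\<close> if there are two, and any nonzero element of \<open>H\<close> otherwise.\<close>

lemma separating_subgroup_for:
  fixes H S :: "'a::{finite, ab_group_add} set"
  assumes H: "subgrp H" "H \<noteq> {0}" and S: "S \<subseteq> coset x H"
  obtains q K where "prime q" "q dvd card (UNIV :: 'a set)" "subgrp K" "K \<subseteq> H" "card K < card H"
    "\<And>g. g \<in> H \<Longrightarrow> \<exists>e. nat_mult (q ^ e) g \<in> K"
    "card S \<ge> 2 \<Longrightarrow> \<exists>s\<in>S. \<exists>s'\<in>S. s - s' \<notin> K"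
proof -
  have "\<exists>z\<in>H. z \<noteq> 0 \<and> (card S \<ge> 2 \<longrightarrow> (\<exists>s\<in>S. \<exists>s'\<in>S. s - s' = z))"
  proof (cases "card S \<ge> 2")
    case True
    then obtain s s' where s: "s \<in> S" "s' \<in> S" "s \<noteq> s'"
      using card_le_Suc0_iff_eq[of S] by fastforce
    have "s - x \<in> H" "s' - x \<in> H" using s S by (auto simp: coset_def)
    then have "s - x - (s' - x) \<in> H" by (rule subgrp_diff[OF H(1)])
    then show ?thesis using s by (intro bexI[of _ "s - s'"]) auto
  next
    case False
    then show ?thesis using H subgrp_zero by blast
  qed
  then obtain z where z: "z \<in> H" "z \<noteq> 0" "card S \<ge> 2 \<longrightarrow> (\<exists>s\<in>S. \<exists>s'\<in>S. s - s' = z)" by auto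
  obtain q K where K: "prime q" "q dvd card (UNIV :: 'a set)" "subgrp K" "K \<subseteq> H" "z \<notin> K"
    "\<And>g. g \<in> H \<Longrightarrow> \<exists>e. nat_mult (q ^ e) g \<in> K"
    using separating_subgroup[OF H(1) z(1,2)] by metis
  then have "card K < card H" using z(1) by (intro psubset_card_mono) auto
  then show ?thesis using K z(3) by (intro that[of q K]) auto
qed

text \<open>Induction on the order of \<open>H\<close>: the bound on the fibres over
  \<open>K\<close> is turned into \<open>kp_vanish\<close>, assembled over \<open>H\<close>, and
  turned back.\<close>

lemma sumset_bound_restricted_sumset:
  fixes A B S H :: "'a::{finite, ab_group_add} set"
  assumes p: "p > 2" "\<And>q. prime q \<Longrightarrow> q dvd card (UNIV :: 'a set) \<Longrightarrow> p \<le> q"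
    and "subgrp H" "A \<noteq> {}" "B \<noteq> {}" "A \<subseteq> coset x H" "B \<subseteq> coset y H" "S \<subseteq> coset (x - y) H"
    and "2 * card S \<le> p + 1" "card (restricted_sumset A S B) < p"
  shows "sumset_bound (card A) (card B) (card S) (card (restricted_sumset A S B))"
  using assms(3-)
proof (induction "card H" arbitrary: H A B S x y rule: less_induct)
  case less
  let ?C = "restricted_sumset A S B"
  have ge1: "card A \<ge> 1" "card B \<ge> 1"
    using less.prems(2,3) by (auto simp: Suc_le_eq card_gt_0_iff)
  show ?case
  proof (cases "H = {0}")
    case True
    then have "A = {x}" "B = {y}" using less.prems by (auto simp: coset_def)
    moreover have "x + y \<in> ?C" if "S = {}" using that calculation by (auto simp: restricted_sumset_def)
    then have "card ?C \<ge> 1" if "S = {}" using that by (auto simp: Suc_le_eq card_gt_0_iff)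
    moreover have "card S \<ge> 1" if "S \<noteq> {}" using that by (simp add: Suc_le_eq card_gt_0_iff)
    ultimately show ?thesis unfolding sumset_bound_def by fastforce
  next
    case False
    obtain q K where K: "prime q" "q dvd card (UNIV :: 'a set)" "subgrp K" "K \<subseteq> H" "card K < card H"
      "\<And>g. g \<in> H \<Longrightarrow> \<exists>e. nat_mult (q ^ e) g \<in> K"
      and sep: "card S \<ge> 2 \<Longrightarrow> \<exists>s\<in>S. \<exists>s'\<in>S. s - s' \<notin> K"
      using separating_subgroup_for[OF less.prems(1) False less.prems(6)] by metis
    have pq: "p \<le> q" using p(2) K by blast
    then have oq: "odd q" using K(1) p(1) prime_odd_nat by simp
    have Mq: "card ?C < q" using less.prems pq by simp
    have "\<exists>N. (card S \<le> 1 \<longrightarrow> N = card S) \<and>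
      (\<forall>s\<in>S. \<forall>s'\<in>S. s - s' \<notin> K \<longrightarrow> N + 2 \<le> 2 * card S) \<and>
      kp_vanish q N (card ?C) (card A) (card B)"
    proof (rule kp_vanish_assemble[OF less.prems(1) K(3,4,1,6) less.prems(4,5,6)])
      show "?C \<subseteq> coset (x + y) H" using less.prems by (intro restricted_sumset_coset)
      fix u v assume uv: "A \<inter> coset u K \<noteq> {}" "B \<inter> coset v K \<noteq> {}"
      let ?F = "restricted_sumset (A \<inter> coset u K) (S \<inter> coset (u - v) K) (B \<inter> coset v K)"
      have F: "?F \<subseteq> ?C \<inter> coset (u + v) K" by (rule restricted_sumset_fiber[OF K(3)])
      have Fc: "card ?F \<le> card (?C \<inter> coset (u + v) K)" by (rule card_mono[OF _ F]) simp
      have "card (?C \<inter> coset (u + v) K) \<le> card ?C" "card (S \<inter> coset (u - v) K) \<le> card S"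
        by (auto intro: card_mono)
      then have "sumset_bound (card (A \<inter> coset u K)) (card (B \<inter> coset v K))
          (card (S \<inter> coset (u - v) K)) (card ?F)"
        using less.prems uv K(3,5) Fc by (intro less.hyps[of K _ _ u v]) auto
      then show "kp_vanish q (2 * card (S \<inter> coset (u - v) K) - 1) (card (?C \<inter> coset (u + v) K))
          (card (A \<inter> coset u K)) (card (B \<inter> coset v K))"
        using Fc by (blast intro: kp_vanish_if_sumset_bound sumset_bound_mono)
    qed
    then obtain N where N: "card S \<le> 1 \<Longrightarrow> N = card S"
      "\<And>s s'. s \<in> S \<Longrightarrow> s' \<in> S \<Longrightarrow> s - s' \<notin> K \<Longrightarrow> N + 2 \<le> 2 * card S"
      "kp_vanish q N (card ?C) (card A) (card B)" by blast
    \<comment> \<open>Separating \<open>S\<close> saves a second unit of weight, which makes up for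
      the loss in the converse step. The bound on \<open>card S\<close> keeps \<open>N\<close> below
      \<open>q\<close>.\<close>
    have N2: "N + 2 \<le> 2 * card S" if "2 \<le> card S" using sep[OF that] N(2) by blast
    moreover have "N < q"
      using N(1) N2 less.prems(7) pq p(1) by (cases "card S \<le> 1") auto
    ultimately show ?thesis
      by (intro sumset_bound_if_kp_vanish[OF K(1) oq Mq ge1 N(3) N(1)])
  qed
qed

lemma kp_vanish_mono: "kp_vanish q n m a b \<Longrightarrow> a' \<le> a \<Longrightarrow> kp_vanish q n m a' b"
  unfolding kp_vanish_def by auto

section \<open>The bound with \<open>3 s\<close> when one coset may hold most of
  \<open>S\<close>\<close>

lemma card_two_cosets:
  fixes X :: "'a::{finite, ab_group_add} set"
  assumes "subgrp K" "c - d \<notin> K"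
  shows "card (X \<inter> coset c K) + card (X \<inter> coset d K) \<le> card X"
proof -
  have "card (X \<inter> coset c K) + card (X \<inter> coset d K) = card (X \<inter> coset c K \<union> X \<inter> coset d K)"
    using coset_disjoint[OF assms] by (intro card_Un_disjoint[symmetric]) auto
  also have "\<dots> \<le> card X" by (intro card_mono) auto
  finally show ?thesis .
qed

lemma card_three_cosets:
  fixes X :: "'a::{finite, ab_group_add} set"
  assumes "subgrp K" "c - d \<notin> K" "c - e \<notin> K" "d - e \<notin> K"
  shows "card (X \<inter> coset c K) + card (X \<inter> coset d K) + card (X \<inter> coset e K) \<le> card X"
proof -
  have "card (X \<inter> coset c K \<union> X \<inter> coset d K \<union> X \<inter> coset e K)
     = card (X \<inter> coset c K \<union> X \<inter> coset d K) + card (X \<inter> coset e K)"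
    using coset_disjoint[OF assms(1,3)] coset_disjoint[OF assms(1,4)] by (intro card_Un_disjoint) auto
  moreover have "card (X \<inter> coset c K \<union> X \<inter> coset d K) = card (X \<inter> coset c K) + card (X \<inter> coset d K)"
    using coset_disjoint[OF assms(1,2)] by (intro card_Un_disjoint) auto
  moreover have "card (X \<inter> coset c K \<union> X \<inter> coset d K \<union> X \<inter> coset e K) \<le> card X"
    by (intro card_mono) auto
  ultimately show ?thesis by simp
qed

lemma restricted_sumset_fiber_bounds:
  fixes A B S K :: "'a::{finite, ab_group_add} set" and u v :: 'a
  defines "m \<equiv> card (restricted_sumset A S B \<inter> coset (u + v) K)"
    and "\<alpha> \<equiv> card (A \<inter> coset u K)" and "\<beta> \<equiv> card (B \<inter> coset v K)"
    and "s \<equiv> card (S \<inter> coset (u - v) K)"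
  assumes p: "p > 2" "\<And>q. prime q \<Longrightarrow> q dvd card (UNIV :: 'a set) \<Longrightarrow> p \<le> q"
    and K: "subgrp K" and ne: "A \<inter> coset u K \<noteq> {}" "B \<inter> coset v K \<noteq> {}"
    and M: "card (restricted_sumset A S B) < p"
  shows "\<alpha> \<le> m + s" "\<beta> \<le> m + s" "2 * s \<le> p + 1 \<Longrightarrow> sumset_bound \<alpha> \<beta> s m"
proof -
  let ?F = "restricted_sumset (A \<inter> coset u K) (S \<inter> coset (u - v) K) (B \<inter> coset v K)"
  have Fc: "card ?F \<le> m"
    unfolding m_def by (rule card_mono[OF _ restricted_sumset_fiber[OF K]]) simp
  show "\<alpha> \<le> m + s" using card_le_restricted_sumset1[OF ne(2)] Fc unfolding \<alpha>_def s_def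
    by (meson add_le_mono1 order.trans)
  show "\<beta> \<le> m + s" using card_le_restricted_sumset2[OF ne(1)] Fc unfolding \<beta>_def s_def
    by (meson add_le_mono1 order.trans)
  have "m \<le> card (restricted_sumset A S B)" unfolding m_def by (intro card_mono) auto
  then have "card ?F < p" using Fc M by simp
  then have "sumset_bound \<alpha> \<beta> s (card ?F)" if "2 * s \<le> p + 1"
    unfolding \<alpha>_def \<beta>_def s_def using that s_def
    by (intro sumset_bound_restricted_sumset[OF p K ne]) auto
  then show "sumset_bound \<alpha> \<beta> s m" if "2 * s \<le> p + 1"
    using that Fc sumset_bound_mono by blast
qed

text \<open>Induction on the order of \<open>H\<close>. Outside the range of the sharp bound, a
  counterexample can be freed of all bad pairs of fibres by deleting at most \<open>card S\<close>
  elements of \<open>A\<close>, and the remaining sizes contradict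
  \<open>not_kp_vanish\<close>.\<close>

lemma restricted_sumset_weak_bound:
  fixes A B S H :: "'a::{finite, ab_group_add} set"
  assumes p: "p > 2" "\<And>q. prime q \<Longrightarrow> q dvd card (UNIV :: 'a set) \<Longrightarrow> p \<le> q"
    and "subgrp H" "A \<noteq> {}" "B \<noteq> {}" "S \<noteq> {}"
    and "A \<subseteq> coset x H" "B \<subseteq> coset y H" "S \<subseteq> coset (x - y) H"
    and "card (restricted_sumset A S B) < p"
  shows "card A + card B \<le> card (restricted_sumset A S B) + 3 * card S"
  using assms(3-)
proof (induction "card H" arbitrary: H A B S x y rule: less_induct)
  case less
  note H = less.prems(1) and sub = less.prems(5-7)
  define C where "C = restricted_sumset A S B"
  have Mp: "card C < p" using less.prems C_def by simp
  have S1: "card S \<ge> 1" using less.prems(4) by (simp add: Suc_le_eq card_gt_0_iff)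
  show ?case
  proof (cases "2 * card S \<le> p + 1")
    case True
    then have "sumset_bound (card A) (card B) (card S) (card C)"
      unfolding C_def using less.prems by (intro sumset_bound_restricted_sumset[OF p H]) auto
    then show ?thesis using S1 unfolding sumset_bound_def C_def by auto
  next
    case False
    show ?thesis
    proof (rule ccontr)
      assume "\<not> ?thesis"
      then have big: "card A + card B \<ge> card C + 3 * card S + 1" by (simp add: C_def)
      have tA: "card A \<le> card C + card S" and tB: "card B \<le> card C + card S"
        unfolding C_def
        using card_le_restricted_sumset1[OF less.prems(3)] card_le_restricted_sumset2[OF less.prems(2)]
        by auto
      have cAB: "card A \<ge> 2 * card S + 1" "card B \<ge> 2 * card S + 1" using big tA tB by auto
      have Sp: "card S + 2 \<le> p" using tA cAB Mp by auto
      have "H \<noteq> {0}"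
      proof
        assume "H = {0}"
        then have "A \<subseteq> {x}" using sub(1) by (auto simp: coset_def)
        then have "card A \<le> 1" using card_mono[of "{x}" A] by simp
        then show False using cAB S1 by simp
      qed
      then obtain q K where K: "prime q" "q dvd card (UNIV :: 'a set)" "subgrp K" "K \<subseteq> H" "card K < card H"
        "\<And>g. g \<in> H \<Longrightarrow> \<exists>e. nat_mult (q ^ e) g \<in> K"
        and sep: "card S \<ge> 2 \<Longrightarrow> \<exists>s\<in>S. \<exists>s'\<in>S. s - s' \<notin> K"
        using separating_subgroup_for[OF H _ sub(3)] by metis
      have sepS: "\<exists>s\<in>S. \<exists>s'\<in>S. s - s' \<notin> K" using sep False p(1) by simp
      have pq: "p \<le> q" using p(2) K by blast
      then have oq: "odd q" using K(1) p(1) prime_odd_nat by simp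
      have Mq: "card C < q" using Mp pq by simp
      define \<alpha> where "\<alpha> u = card (A \<inter> coset u K)" for u
      define \<beta> where "\<beta> v = card (B \<inter> coset v K)" for v
      define \<sigma> where "\<sigma> d = card (S \<inter> coset d K)" for d
      define m where "m c = card (C \<inter> coset c K)" for c
      note defs = \<alpha>_def \<beta>_def \<sigma>_def m_def
      have fib: "\<alpha> u \<le> m (u + v) + \<sigma> (u - v)" "\<beta> v \<le> m (u + v) + \<sigma> (u - v)"
        "2 * \<sigma> (u - v) \<le> p + 1 \<Longrightarrow> sumset_bound (\<alpha> u) (\<beta> v) (\<sigma> (u - v)) (m (u + v))"
        if "\<alpha> u > 0" "\<beta> v > 0" for u v
        using restricted_sumset_fiber_bounds[OF p K(3), of A u B v S] that less.prems(8)
        by (auto simp: C_def defs card_gt_0_iff)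
      \<comment> \<open>The deletion leaves total size at least
        \<open>card C + 2 * card S + 1\<close>, while separation bounds \<open>N\<close> by
        \<open>2 * card S - 2\<close>. The divisibility condition of \<open>not_kp_vanish\<close> is
        vacuous, as \<open>card B\<close> exceeds \<open>N\<close>.\<close>
      have delete: False
        if "D \<subseteq> A" "card D \<le> card S"
          and loc: "\<And>u v. \<alpha> u > 0 \<Longrightarrow> \<beta> v > 0 \<Longrightarrow>
            kp_vanish q (2 * \<sigma> (u - v) - 1) (m (u + v)) (card ((A - D) \<inter> coset u K)) (\<beta> v)" for D
      proof -
        have "\<exists>N. (card S \<le> 1 \<longrightarrow> N = card S) \<and>
          (\<forall>s\<in>S. \<forall>s'\<in>S. s - s' \<notin> K \<longrightarrow> N + 2 \<le> 2 * card S) \<and>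
          kp_vanish q N (card C) (card (A - D)) (card B)"
        proof (rule kp_vanish_assemble[OF H K(3,4,1,6) _ sub(2,3)])
          show "A - D \<subseteq> coset x H" using sub by auto
          show "C \<subseteq> coset (x + y) H" unfolding C_def using sub H by (intro restricted_sumset_coset)
          fix u v assume uv: "(A - D) \<inter> coset u K \<noteq> {}" "B \<inter> coset v K \<noteq> {}"
          then have "\<alpha> u > 0" "\<beta> v > 0" by (auto simp: defs card_gt_0_iff)
          then show "kp_vanish q (2 * card (S \<inter> coset (u - v) K) - 1) (card (C \<inter> coset (u + v) K))
            (card ((A - D) \<inter> coset u K)) (card (B \<inter> coset v K))"
            using loc unfolding defs by blast
        qed
        then obtain N where N: "N + 2 \<le> 2 * card S" "kp_vanish q N (card C) (card (A - D)) (card B)"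
          using sepS by blast
        have cD: "card (A - D) = card A - card D" using that(1) by (simp add: card_Diff_subset)
        have "\<not> kp_vanish q N (card C) (card (A - D)) (card B)"
          using N(1) cD cAB that(2) big by (intro not_kp_vanish K(1) oq Mq) auto
        with N(2) show False by simp
      qed
      \<comment> \<open>Only such pairs can fail: for a small fibre of \<open>S\<close> the sharp
        bound applies, and if one fibre has size at most \<sigma>, the trivial bound on the other
        suffices.\<close>
      define trouble where
        "trouble u v \<longleftrightarrow> 2 * \<sigma> (u - v) \<ge> p + 2 \<and> \<alpha> u > \<sigma> (u - v) \<and> \<beta> v > \<sigma> (u - v)" for u v
      have ok: "kp_vanish q (2 * \<sigma> (u - v) - 1) (m (u + v)) (card ((A - D) \<inter> coset u K)) (\<beta> v)"
        if "\<alpha> u > 0" "\<beta> v > 0" "\<not> trouble u v" for u v D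
      proof (rule kp_vanish_mono)
        show "card ((A - D) \<inter> coset u K) \<le> \<alpha> u" unfolding defs by (intro card_mono) auto
        show "kp_vanish q (2 * \<sigma> (u - v) - 1) (m (u + v)) (\<alpha> u) (\<beta> v)"
        proof (cases "2 * \<sigma> (u - v) \<le> p + 1")
          case True
          then show ?thesis using fib(3)[OF that(1,2)] by (intro kp_vanish_if_sumset_bound)
        next
          case False
          then show ?thesis
            using that fib(1,2)[OF that(1,2)] unfolding trouble_def by (intro kp_vanish_trivial) auto
        qed
      qed
      have "\<exists>u v. trouble u v"
      proof (rule ccontr)
        assume "\<not> (\<exists>u v. trouble u v)"
        then show False using ok[where D = "{}"] by (intro delete[of "{}"]) auto
      qed
      then obtain u0 v0 where t0: "trouble u0 v0" by blast
      define d where "d = u0 - v0"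
      define s where "s = \<sigma> d"
      have s: "2 * s \<ge> p + 2" using t0 by (simp add: trouble_def s_def d_def)
      \<comment> \<open>Two such cosets would together hold at least \<open>p + 2\<close> elements
        of \<open>S\<close>, but \<open>card S + 2\<close> is at most \<open>p\<close>. Hence a
        troubled pair is determined, up to \<open>K\<close>, by its first entry.\<close>
      have same: "coset (u - v) K = coset d K" if "trouble u v" for u v
      proof (rule ccontr)
        assume "coset (u - v) K \<noteq> coset d K"
        then have "u - v - d \<notin> K" using coset_cong[OF K(3)] by blast
        from card_two_cosets[OF K(3) this, of S] show False
          using that s Sp unfolding trouble_def s_def \<sigma>_def by auto
      qed
      define Tr where "Tr u \<longleftrightarrow> \<alpha> u > s \<and> \<beta> (u - d) > s" for u
      have Tr: "Tr u \<and> \<sigma> (u - v) = s" if "trouble u v" for u v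
      proof -
        have "u - v \<in> coset d K" using same[OF that] coset_self[OF K(3)] by blast
        then have "(u - d) - v \<in> K" by (simp add: coset_def algebra_simps)
        then have "coset (u - d) K = coset v K" by (rule coset_cong[OF K(3)])
        moreover have "\<sigma> (u - v) = s" unfolding \<sigma>_def s_def same[OF that] ..
        ultimately show ?thesis using that unfolding Tr_def trouble_def \<beta>_def by simp
      qed
      have Tr0: "Tr u0" using Tr[OF t0] by simp
      have TrH: "u - u' \<in> H" if "Tr u" "Tr u'" for u u'
      proof -
        have "u - x \<in> H" if "Tr u" for u
        proof -
          have "A \<inter> coset u K \<noteq> {}" using that unfolding Tr_def \<alpha>_def by (auto simp: card_gt_0_iff)
          then obtain a where "a \<in> A" "a - u \<in> K" by (auto simp: coset_def)
          then have "a - x \<in> H" "a - u \<in> H" using sub K(4) by (auto simp: coset_def)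
          then have "(a - x) - (a - u) \<in> H" by (rule subgrp_diff[OF H])
          then show ?thesis by simp
        qed
        then have "(u - x) - (u' - x) \<in> H" using that subgrp_diff[OF H] by blast
        then show ?thesis by simp
      qed
      have double: "z + z \<notin> K" if z: "z \<in> H" "z \<notin> K" for z
      proof
        assume "z + z \<in> K"
        then have "nat_mult 2 z \<in> K" by (simp add: numeral_2_eq_2)
        moreover obtain e where "nat_mult (q ^ e) z \<in> K" using K(6) z by blast
        moreover have "coprime 2 (q ^ e)" using oq by simp
        ultimately show False using subgrp_nat_mult_coprime[OF K(3)] z by blast
      qed
      \<comment> \<open>The pairs \<open>(u, u' - d)\<close> and \<open>(u', u - d)\<close> have the
        same sum, and their difference cosets are distinct from each other and from that of
        \<open>d\<close>. One of them contains at most half of the other \<open>card S - s\<close>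
        elements, so the sharp bound applies.\<close>
      have cross: "m (u + u' - d) + card S \<ge> 3 * s + 1"
        if T: "Tr u" "Tr u'" and nK: "u - u' \<notin> K" for u u'
      proof -
        have *: "m (u + u' - d) + card S \<ge> 3 * s + 1"
          if T: "Tr u" "Tr u'" and le: "s + 2 * \<sigma> (d + (u - u')) \<le> card S" for u u'
        proof -
          let ?d = "d + (u - u')"
          have d: "u - (u' - d) = ?d" "u + (u' - d) = u + u' - d" by (simp_all add: algebra_simps)
          have pos: "\<alpha> u > s" "\<beta> (u' - d) > s" using T by (auto simp: Tr_def)
          then have "sumset_bound (\<alpha> u) (\<beta> (u' - d)) (\<sigma> ?d) (m (u + u' - d))"
            using fib(3)[of u "u' - d"] le Sp unfolding d by simp
          then show ?thesis using pos le unfolding sumset_bound_def by auto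
        qed
        have uK: "u' - u \<notin> K" using nK subgrp_minus[OF K(3), of "u' - u"] by auto
        have "(d + (u - u')) - (d + (u' - u)) = (u - u') + (u - u')" by (simp add: algebra_simps)
        then have "(d + (u - u')) - (d + (u' - u)) \<notin> K" using double[OF TrH[OF T] nK] by (simp only: not_False_eq_True)
        moreover have "(d + (u - u')) - d \<notin> K" "(d + (u' - u)) - d \<notin> K" using nK uK by simp_all
        ultimately have "\<sigma> (d + (u - u')) + \<sigma> (d + (u' - u)) + s \<le> card S"
          unfolding \<sigma>_def s_def by (intro card_three_cosets K(3))
        then have "s + 2 * \<sigma> (d + (u - u')) \<le> card S \<or> s + 2 * \<sigma> (d + (u' - u)) \<le> card S" by linarith
        then show ?thesis using *[OF T] *[OF T(2,1)] by (auto simp: add.commute)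
      qed
      show False
      proof (cases "\<forall>u. Tr u \<longrightarrow> u - u0 \<in> K")
        case True
        \<comment> \<open>With one troubled coset, removing \<open>s\<close> elements turns the
          inductive bound with \<open>3 s\<close> into the \<open>2 s\<close> required.\<close>
        obtain D where D: "D \<subseteq> A \<inter> coset u0 K" "card D = s"
          using obtain_subset_with_card_n[of s "A \<inter> coset u0 K"] Tr0 unfolding Tr_def \<alpha>_def by auto
        show False
        proof (rule delete)
          show "D \<subseteq> A" using D by auto
          show "card D \<le> card S" unfolding D(2) s_def \<sigma>_def by (intro card_mono) auto
          fix u v assume uv: "\<alpha> u > 0" "\<beta> v > 0"
          show "kp_vanish q (2 * \<sigma> (u - v) - 1) (m (u + v)) (card ((A - D) \<inter> coset u K)) (\<beta> v)"
          proof (cases "trouble u v")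
            case False
            then show ?thesis using ok uv by blast
          next
            case t: True
            then have us: "coset u K = coset u0 K" "\<sigma> (u - v) = s"
              using Tr[OF t] True coset_cong[OF K(3)] by auto
            have "(A - D) \<inter> coset u K = (A \<inter> coset u K) - D" by auto
            then have 1: "card ((A - D) \<inter> coset u K) = \<alpha> u - s"
              unfolding \<alpha>_def using D us(1) by (simp add: card_Diff_subset)
            let ?F = "restricted_sumset (A \<inter> coset u K) (S \<inter> coset (u - v) K) (B \<inter> coset v K)"
            have F: "card ?F \<le> m (u + v)"
              unfolding m_def C_def by (rule card_mono[OF _ restricted_sumset_fiber[OF K(3)]]) simp
            moreover have "m (u + v) \<le> card C" unfolding m_def by (intro card_mono) auto
            ultimately have "\<alpha> u + \<beta> v \<le> card ?F + 3 * \<sigma> (u - v)"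
              unfolding defs using uv us s Mp K(3,5)
              by (intro less.hyps[of K _ _ _ u v]) (auto simp: defs card_gt_0_iff)
            moreover have "\<alpha> u > s" using Tr[OF t] by (simp add: Tr_def)
            ultimately show ?thesis using 1 F us(2) s by (intro kp_vanish_trivial) auto
          qed
        qed
      next
        case False
        then obtain u1 where u1: "Tr u1" "u1 - u0 \<notin> K" by blast
        have u01: "u0 - u1 \<notin> K" using u1 subgrp_minus[OF K(3), of "u0 - u1"] by auto
        \<comment> \<open>A third troubled coset would give two cross sums in different cosets, with
          too many elements of \<open>C\<close> in total.\<close>
        have only: "u - u0 \<in> K \<or> u - u1 \<in> K" if T: "Tr u" for u
        proof (rule ccontr)
          assume "\<not> ?thesis"
          then have n: "u - u0 \<notin> K" "u - u1 \<notin> K" by auto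
          have "(u + u0 - d) - (u + u1 - d) \<notin> K" using u01 by simp
          then have "m (u + u0 - d) + m (u + u1 - d) \<le> card C"
            unfolding m_def by (rule card_two_cosets[OF K(3)])
          then show False using cross[OF T Tr0 n(1)] cross[OF T u1(1) n(2)] Mp Sp s by linarith
        qed
        have mi: "\<alpha> u \<le> m (u + u - d) + s" if "Tr u" for u
          using fib(1)[of u "u - d"] that unfolding Tr_def s_def by (auto simp: add_diff_eq)
        have "(u0 + u0 - d) - (u1 + u1 - d) = (u0 - u1) + (u0 - u1)" by (simp add: algebra_simps)
        then have "(u0 + u0 - d) - (u1 + u1 - d) \<notin> K" using double[OF TrH[OF Tr0 u1(1)] u01]
          by (simp only: not_False_eq_True)
        moreover have "(u0 + u0 - d) - (u0 + u1 - d) \<notin> K" "(u1 + u1 - d) - (u0 + u1 - d) \<notin> K"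
          using u01 u1(2) by (simp_all add: algebra_simps)
        ultimately have "m (u0 + u0 - d) + m (u1 + u1 - d) + m (u0 + u1 - d) \<le> card C"
          unfolding m_def by (rule card_three_cosets[OF K(3)])
        \<comment> \<open>The excess of both fibres over \<open>s\<close> is bounded by the part of
          \<open>C\<close> over the two doubled sums; the cross sum already takes up
          \<open>3 * s + 1 - card S\<close> elements.\<close>
        then have cost: "(\<alpha> u0 - s) + (\<alpha> u1 - s) \<le> card S"
          using cross[OF Tr0 u1(1) u01] mi[OF Tr0] mi[OF u1(1)] Mp Sp s by linarith
        obtain D0 where D0: "D0 \<subseteq> A \<inter> coset u0 K" "card D0 = \<alpha> u0 - s"
          using obtain_subset_with_card_n[of "\<alpha> u0 - s" "A \<inter> coset u0 K"] unfolding \<alpha>_def by auto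
        obtain D1 where D1: "D1 \<subseteq> A \<inter> coset u1 K" "card D1 = \<alpha> u1 - s"
          using obtain_subset_with_card_n[of "\<alpha> u1 - s" "A \<inter> coset u1 K"] unfolding \<alpha>_def by auto
        show False
        proof (rule delete)
          show "D0 \<union> D1 \<subseteq> A" using D0 D1 by auto
          show "card (D0 \<union> D1) \<le> card S" using cost D0 D1 card_Un_le[of D0 D1] by simp
          fix u v assume uv: "\<alpha> u > 0" "\<beta> v > 0"
          show "kp_vanish q (2 * \<sigma> (u - v) - 1) (m (u + v)) (card ((A - (D0 \<union> D1)) \<inter> coset u K)) (\<beta> v)"
          proof (cases "trouble u v")
            case False
            then show ?thesis using ok uv by blast
          next
            case t: True
            then have us: "Tr u" "\<sigma> (u - v) = s" using Tr by auto
            have *: "card ((A - (D0 \<union> D1)) \<inter> coset u K) \<le> s"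
              if "D \<subseteq> A \<inter> coset w K" "card D = \<alpha> w - s" "D \<subseteq> D0 \<union> D1" "u - w \<in> K" for D w
            proof -
              have c: "coset u K = coset w K" using that(4) by (rule coset_cong[OF K(3)])
              have "card ((A - (D0 \<union> D1)) \<inter> coset u K) \<le> card ((A \<inter> coset w K) - D)"
                unfolding c using that(3) by (intro card_mono) auto
              also have "\<dots> = \<alpha> w - card D" unfolding \<alpha>_def using that(1) by (simp add: card_Diff_subset)
              finally show ?thesis using that(2) by simp
            qed
            \<comment> \<open>Both troubled fibres of \<open>A\<close> are cut down to size
              \<open>s\<close>, where the trivial bound on the fibre of \<open>B\<close>
              suffices.\<close>
            have "card ((A - (D0 \<union> D1)) \<inter> coset u K) \<le> s"
              using only[OF us(1)] *[OF D0] *[OF D1] by blast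
            then show ?thesis using fib(2)[OF uv] us s by (intro kp_vanish_trivial) auto
          qed
        qed
      qed
    qed
  qed
qed

lemma least_prime_factor_le:
  assumes "prime q" "q dvd n"
  shows "least_prime_factor n \<le> q"
  unfolding least_prime_factor_def using assms by (intro Least_le) auto

theorem theorem1p1:
  fixes A B S :: "'a::{finite, ab_group_add} set"
  assumes "A \<noteq> {}" and "B \<noteq> {}" and "S \<noteq> {}"
  shows "int (card (restricted_sumset A S B))
           \<ge> min (int (card A) + int (card B) - 3 * int (card S))
                  (int (least_prime_factor (card (UNIV :: 'a set))))"
proof -
  let ?p = "least_prime_factor (card (UNIV :: 'a set))" and ?C = "restricted_sumset A S B"
  have S1: "card S \<ge> 1" using assms(3) by (simp add: Suc_le_eq card_gt_0_iff)
  have t: "card A \<le> card ?C + card S" "card B \<le> card ?C + card S"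
    using card_le_restricted_sumset1[OF assms(2)] card_le_restricted_sumset2[OF assms(1)] by auto
  \<comment> \<open>For the one-element group \<open>?p\<close> is an unspecified number; the cases
    cover any value, and no prime divides 1.\<close>
  consider "?p \<le> card ?C" | "?p \<le> 2" | "?p > 2" "card ?C < ?p" by linarith
  then show ?thesis
  proof cases
    \<comment> \<open>If \<open>card ?C\<close> is below \<open>?p\<close> it is at most 1, hence at
      most \<open>card S\<close>, and adding the two trivial bounds suffices.\<close>
    case 2
    then show ?thesis using t S1 by linarith
  next
    case 3
    have "card A + card B \<le> card ?C + 3 * card S"
      using assms 3 least_prime_factor_le
      by (intro restricted_sumset_weak_bound[of ?p UNIV _ _ _ 0 0]) (auto simp: subgrp_def coset_def)
    then show ?thesis by linarith
  qed simp
qed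

end
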